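(* Fix an RBG allocation $\mathbf k$. Let $\mathbf V^{(0)}$ be a feasible point (i.e. $\|\mathbf V^{(0)}_{u,i}\|_F^2\le P_{\max}$ for every active slot $(u,i)\in\mathcal S$), and let $(\mathbf V^{(\tau)})_{\tau\ge0}$ be the beamformer sequence generated, for $\tau\ge1$ and $(u,i)\in\mathcal S$, by $$\mathbf V_{u,i}^{(\tau)}=\mathcal P_{\mathcal W}\Big[\mathbf V_{u,i}^{(\tau-1)}+\alpha_{u,i}^{(\tau)}\big(\widetilde{\mathbf V}_{u,i}^{\mathrm{FP},(\tau)}-\mathbf V_{u,i}^{(\tau-1)}\big)\Big],\qquad \widetilde{\mathbf V}_{u,i}^{\mathrm{FP},(\tau)}=\mathbf V_{u,i}^{(\tau-1)}+\frac{1}{\lambda_{u,i}^{(\tau)}}\Big(\mathbf\Lambda_{u,i}^{(\tau)}-\mathbf L_{u,i}^{(\tau)}\mathbf V_{u,i}^{(\tau-1)}\Big),$$ where $\mathbf\Lambda_{u,i}^{(\tau)},\mathbf L_{u,i}^{(\tau)}$ are computed at $\mathbf V^{(\tau-1)}$ and $\lambda_{u,i}^{(\tau)}>0$ is chosen with $\lambda_{u,i}^{(\tau)}\ge\lambda_{\max}(\mathbf L_{u,i}^{(\tau)})$. Assume that the relaxation factors $\alpha_{u,i}^{(\tau)}$ remain in a compact subset of $(0,2)$. Then: 1. every accumulation point of $(\mathbf V^{(\tau)})_{\tau\ge 0}$ is stationary for the beamforming subproblem of the surrogate problem $\max f_{\mathrm{P4}}$ (both defined in the context); 2. the weighted-sum-rate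 (WSR) objective sequence $\big(f(\mathbf V^{(\tau)};\mathbf k)\big)_{\tau\ge0}$ converges.
   Context: **Network.** There are finitely many base stations, users $u\in[U]$, and resource block groups (RBGs) $[K]$, where $[n]=\{0,\dots,n-1\}$. User $u$ is served by base station $b_u$, has priority weight $\rho_u\ge 0$, receives $d_u$ streams, and has $N$ logical slots $i\in[N]$. Each base station has $M_t$ transmit antennas and each user $M_r$ receive antennas. $\mathbf H_{b,n,u}\in\mathbb C^{M_r\times M_t}$ is the given channel from base station $b$ to user $u$ on RBG $n$. The noise power is $\sigma^2>0$ and the power budget is $P_{\max}>0$. **Allocation.** An RBG allocation $\mathbf k=(k_{u,i})$ assigns to each slot $(u,i)$ an element $k_{u,i}\in[K]\cup\{\emptyset\}$. The slot is active if $k_{u,i}\ne\emptyset$; $\mathcal S$ denotes the set of active slots. Inactive slots contribute nothing. For an active slot, $\mathcal C_{u,i}=\{(j,\ell)\in\mathcal S: k_{j,\ell}=k_{u,i}\}$ and $\mathbf H_{u,i}=\mathbf H_{b_u,k_{u,i},u}$. **WSR objective.** The variable is $\mathbf V=\{\mathbf V_{u,i}\}_{(u,i)\in\mathcal S}$ with $\mathbf V_{u,i}\in\mathbb C^{M_t\times d_u}$. Put $$\mathbf M_{u,i}(\mathbf V)=\sum_{(j,\ell)\in\mathcal C_{u,i}\setminus\{(u,i)\}}\mathbf H_{b_j,k_{u,i},u}\mathbf V_{j,\ell}\mathbf V_{j,\ell}^H\mathbf H_{b_j,k_{u,i},u}^H+\sigma^2\mathbf I_{M_r},$$ $$\mathbf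 J_{u,i}(\mathbf V)=\mathbf H_{u,i}\mathbf V_{u,i}\mathbf V_{u,i}^H\mathbf H_{u,i}^H+\mathbf M_{u,i}(\mathbf V),$$ $$f(\mathbf V;\mathbf k)=\sum_{(u,i)\in\mathcal S}\rho_u\log\det\big(\mathbf I_{d_u}+\mathbf V_{u,i}^H\mathbf H_{u,i}^H\mathbf M_{u,i}(\mathbf V)^{-1}\mathbf H_{u,i}\mathbf V_{u,i}\big),$$ with natural logarithm. $\mathbf V$ is feasible if $\|\mathbf V_{u,i}\|_F^2\le P_{\max}$ for all $(u,i)\in\mathcal S$. **Auxiliary quantities.** For given $\mathbf\Gamma_{u,i}\in\mathbb C^{d_u\times d_u}$ and $\mathbf Y_{u,i}\in\mathbb C^{M_r\times d_u}$, set $$\mathbf\Lambda_{u,i}=\rho_u\mathbf H_{u,i}^H\mathbf Y_{u,i}(\mathbf I_{d_u}+\mathbf\Gamma_{u,i}),\qquad \mathbf\Psi_{j,\ell}=\mathbf Y_{j,\ell}(\mathbf I_{d_j}+\mathbf\Gamma_{j,\ell})\mathbf Y_{j,\ell}^{H},$$ $$\mathbf L_{u,i}=\sum_{(j,\ell)\in\mathcal C_{u,i}}\rho_j\,\mathbf H_{b_u,k_{u,i},j}^H\mathbf\Psi_{j,\ell}\mathbf H_{b_u,k_{u,i},j}.$$ The auxiliary updates at a point $\mathbf V$ are $$\mathbf\Gamma_{u,i}(\mathbf V)=\mathbf V_{u,i}^H\mathbf H_{u,i}^H\mathbf M_{u,i}(\mathbf V)^{-1}\mathbf H_{u,i}\mathbf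 V_{u,i},\qquad \mathbf Y_{u,i}(\mathbf V)=\mathbf J_{u,i}(\mathbf V)^{-1}\mathbf H_{u,i}\mathbf V_{u,i}.$$ $\mathbf\Lambda_{u,i}^{(\tau)}$ and $\mathbf L_{u,i}^{(\tau)}$ are $\mathbf\Lambda_{u,i}$ and $\mathbf L_{u,i}$ formed with $\mathbf\Gamma=\mathbf\Gamma(\mathbf V^{(\tau-1)})$, $\mathbf Y=\mathbf Y(\mathbf V^{(\tau-1)})$. $\lambda_{\max}(\cdot)$ is the largest eigenvalue of a Hermitian matrix. **Surrogate problem.** With $\lambda_{u,i}\ge\lambda_{\max}(\mathbf L_{u,i})$ and $\mathbf Z=\{\mathbf Z_{u,i}\}$, $\mathbf Z_{u,i}\in\mathbb C^{M_t\times d_u}$, $$\begin{aligned}f_{\mathrm{P4}}(\mathbf V,\mathbf\Gamma,\mathbf Y,\mathbf Z)=\sum_{(u,i)\in\mathcal S}\Big[&\rho_u\log\det(\mathbf I_{d_u}+\mathbf\Gamma_{u,i})-\rho_u\operatorname{Tr}(\mathbf\Gamma_{u,i})-\rho_u\sigma^2\operatorname{Tr}\big(\mathbf Y_{u,i}^H\mathbf Y_{u,i}(\mathbf I_{d_u}+\mathbf\Gamma_{u,i})\big)-\lambda_{u,i}\operatorname{Tr}(\mathbf V_{u,i}^H\mathbf V_{u,i})\\&+2\Re\operatorname{Tr}\big(\mathbf V_{u,i}^H\mathbf\Lambda_{u,i}+\mathbf V_{u,i}^H(\lambda_{u,i}\mathbf I_{M_t}-\mathbf L_{u,i})\mathbf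 Z_{u,i}\big)-\operatorname{Tr}\big(\mathbf Z_{u,i}^H(\lambda_{u,i}\mathbf I_{M_t}-\mathbf L_{u,i})\mathbf Z_{u,i}\big)\Big].\end{aligned}$$ The surrogate problem is to maximize $f_{\mathrm{P4}}$ over $(\mathbf V,\mathbf\Gamma,\mathbf Y,\mathbf Z)$ with $\mathbf V$ feasible, for the fixed $\mathbf k$. Its beamforming subproblem is the maximization over feasible $\mathbf V$ with the auxiliary variables fixed at their updates. **Stationarity.** A feasible $\mathbf V^\star$ is stationary for the beamforming subproblem if, with $\mathbf\Gamma^\star=\mathbf\Gamma(\mathbf V^\star)$, $\mathbf Y^\star=\mathbf Y(\mathbf V^\star)$, $\mathbf Z^\star=\mathbf V^\star$, one has $\langle\nabla_{\mathbf V}f_{\mathrm{P4}}(\mathbf V^\star,\mathbf\Gamma^\star,\mathbf Y^\star,\mathbf Z^\star),\mathbf V-\mathbf V^\star\rangle\le0$ for every feasible $\mathbf V$, where complex matrices are regarded as a real vector space with inner product $\langle\mathbf A,\mathbf B\rangle=\sum_{(u,i)\in\mathcal S}\Re\operatorname{Tr}(\mathbf A_{u,i}^H\mathbf B_{u,i})$. (This gradient does not depend on the choice of $\lambda_{u,i}$.) **Projection.** $\mathcal P_{\mathcal W}$ is the Euclidean (Frobenius) projection onto the ball $\{\mathbf X:\|\mathbf X\|_F^2\le P_{\max}\}$, i.e. $\mathcal P_{\mathcal W}(\mathbf X)=\min\{1,\sqrt{P_{\max}}/\|\mathbf X\|_F\}\,\mathbf X$ (and $\mathcal P_{\mathcal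 W}(\mathbf 0)=\mathbf 0$).
   Formalization: Part 1 (stationarity of accumulation points) is proved under the added assumption that the chosen λ_{u,i}^{(τ)} are bounded above; without it part 1 fails (e.g. scalar case, λ^{(τ)}=2^{τ+1}, α=1). Part 2 needs no such bound. *)

theory Defs
  imports
    Complex_Main
    "Jordan_Normal_Form.Gauss_Jordan_Elimination"
    "Jordan_Normal_Form.Schur_Decomposition"
begin

section \<open>Complex matrices\<close>

text \<open>All matrices are dimension-carrying matrices (\<open>complex mat\<close>), since the number of
  columns of a beamformer depends on the user.\<close>

definition tr :: "complex mat \<Rightarrow> complex" where
  "tr A = (\<Sum>r<dim_row A. A $$ (r, r))"

definition frob_norm :: "complex mat \<Rightarrow> real" where
  "frob_norm A = sqrt (\<Sum>r<dim_row A. \<Sum>c<dim_col A. (cmod (A $$ (r, c)))\<^sup>2)"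

text \<open>The type of matrices has no dimension-independent zero, so \<open>sum\<close> is not available on it.\<close>

definition msum :: "nat \<Rightarrow> nat \<Rightarrow> ('a \<Rightarrow> complex mat) \<Rightarrow> 'a set \<Rightarrow> complex mat" where
  "msum nr nc A I = mat nr nc (\<lambda>(r, c). \<Sum>x\<in>I. A x $$ (r, c))"

text \<open>Only meaningful for invertible matrices; \<open>mat_inverse\<close> is the library's partial inverse.\<close>

definition minv :: "complex mat \<Rightarrow> complex mat" where
  "minv A = the (mat_inverse A)"

text \<open>Real part of the determinant: every determinant whose logarithm matters below is that of
  a Hermitian positive definite matrix, hence a positive real.\<close>

definition logdet :: "complex mat \<Rightarrow> real" where
  "logdet A = ln (Re (det A))"

text \<open>Used for Hermitian matrices, whose eigenvalues are all real.\<close>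

definition lambda_max :: "complex mat \<Rightarrow> real" where
  "lambda_max A = Max {x. eigenvalue A (complex_of_real x)}"

text \<open>For the zero matrix the scaling factor is \<open>0\<close> because \<open>x / 0 = 0\<close>, so the
  result is again the zero matrix.\<close>

definition proj_ball :: "real \<Rightarrow> complex mat \<Rightarrow> complex mat" where
  "proj_ball P X = complex_of_real (min 1 (sqrt P / frob_norm X)) \<cdot>\<^sub>m X"


section \<open>Network and allocation\<close>

text \<open>\<open>chan net b n u\<close> is the channel from base station \<open>b\<close> to user \<open>u\<close> on RBG \<open>n\<close>;
  \<open>noise_power\<close> is the number \<open>\<sigma>\<^sup>2\<close>.\<close>

record network =
  bs_count :: nat
  user_count :: nat
  rbg_count :: nat
  slot_count :: nat
  tx_antennas :: nat
  rx_antennas :: nat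
  serving :: "nat \<Rightarrow> nat"
  weight :: "nat \<Rightarrow> real"
  streams :: "nat \<Rightarrow> nat"
  chan :: "nat \<Rightarrow> nat \<Rightarrow> nat \<Rightarrow> complex mat"
  noise_power :: real
  power_budget :: real

definition valid_network :: "network \<Rightarrow> bool" where
  "valid_network net \<longleftrightarrow>
     (\<forall>u<user_count net. serving net u < bs_count net \<and> 0 \<le> weight net u) \<and>
     (\<forall>b<bs_count net. \<forall>n<rbg_count net. \<forall>u<user_count net.
        chan net b n u \<in> carrier_mat (rx_antennas net) (tx_antennas net)) \<and>
     0 < noise_power net \<and> 0 < power_budget net"

text \<open>Slots are pairs \<open>(u, i)\<close>; \<open>None\<close> stands for the empty assignment.\<close>

type_synonym slot = "nat \<times> nat"
type_synonym allocation = "slot \<Rightarrow> nat option"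
type_synonym mat_family = "slot \<Rightarrow> complex mat"

definition rbg_allocation :: "network \<Rightarrow> allocation \<Rightarrow> bool" where
  "rbg_allocation net k \<longleftrightarrow>
     (\<forall>u<user_count net. \<forall>i<slot_count net. \<forall>n. k (u, i) = Some n \<longrightarrow> n < rbg_count net)"

definition active :: "network \<Rightarrow> allocation \<Rightarrow> slot set" where
  "active net k = {(u, i). u < user_count net \<and> i < slot_count net \<and> k (u, i) \<noteq> None}"

definition cochannel :: "network \<Rightarrow> allocation \<Rightarrow> slot \<Rightarrow> slot set" where
  "cochannel net k p = {q \<in> active net k. k q = k p}"

text \<open>\<open>chan_from net k q p\<close> is the channel from the base station serving slot \<open>q\<close> to the user
  of slot \<open>p\<close>, on the RBG of slot \<open>p\<close>. With \<open>p = q\<close> it is the direct channel of \<open>p\<close>.\<close>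

definition chan_from :: "network \<Rightarrow> allocation \<Rightarrow> slot \<Rightarrow> slot \<Rightarrow> complex mat" where
  "chan_from net k q p = chan net (serving net (fst q)) (the (k p)) (fst p)"

abbreviation direct_chan :: "network \<Rightarrow> allocation \<Rightarrow> slot \<Rightarrow> complex mat" where
  "direct_chan net k p \<equiv> chan_from net k p p"


section \<open>Beamformers and the weighted sum rate\<close>

text \<open>Only the values of a family at active slots are relevant.\<close>

definition beam_space :: "network \<Rightarrow> allocation \<Rightarrow> mat_family set" where
  "beam_space net k =
     {V. \<forall>p\<in>active net k. V p \<in> carrier_mat (tx_antennas net) (streams net (fst p))}"

definition feasible :: "network \<Rightarrow> allocation \<Rightarrow> mat_family \<Rightarrow> bool" where
  "feasible net k V \<longleftrightarrow>
     V \<in> beam_space net k \<and> (\<forall>p\<in>active net k. (frob_norm (V p))\<^sup>2 \<le> power_budget net)"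

definition rx_cov :: "network \<Rightarrow> allocation \<Rightarrow> mat_family \<Rightarrow> slot \<Rightarrow> slot \<Rightarrow> complex mat" where
  "rx_cov net k V p q =
     chan_from net k q p * V q * mat_adjoint (V q) * mat_adjoint (chan_from net k q p)"

definition M_mat :: "network \<Rightarrow> allocation \<Rightarrow> mat_family \<Rightarrow> slot \<Rightarrow> complex mat" where
  "M_mat net k V p =
     msum (rx_antennas net) (rx_antennas net) (rx_cov net k V p) (cochannel net k p - {p})
     + complex_of_real (noise_power net) \<cdot>\<^sub>m 1\<^sub>m (rx_antennas net)"

definition J_mat :: "network \<Rightarrow> allocation \<Rightarrow> mat_family \<Rightarrow> slot \<Rightarrow> complex mat" where
  "J_mat net k V p = rx_cov net k V p p + M_mat net k V p"

definition Gamma_upd :: "network \<Rightarrow> allocation \<Rightarrow> mat_family \<Rightarrow> mat_family" where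
  "Gamma_upd net k V p =
     mat_adjoint (V p) * mat_adjoint (direct_chan net k p) * minv (M_mat net k V p)
     * direct_chan net k p * V p"

definition Y_upd :: "network \<Rightarrow> allocation \<Rightarrow> mat_family \<Rightarrow> mat_family" where
  "Y_upd net k V p = minv (J_mat net k V p) * direct_chan net k p * V p"

text \<open>The matrix inside the determinant of the weighted sum rate is the identity plus the
  update \<open>Gamma_upd\<close>.\<close>

definition wsr :: "network \<Rightarrow> allocation \<Rightarrow> mat_family \<Rightarrow> real" where
  "wsr net k V =
     (\<Sum>p\<in>active net k.
        weight net (fst p) * logdet (1\<^sub>m (streams net (fst p)) + Gamma_upd net k V p))"


section \<open>The surrogate objective\<close>

definition Lambda_mat ::
  "network \<Rightarrow> allocation \<Rightarrow> mat_family \<Rightarrow> mat_family \<Rightarrow> slot \<Rightarrow> complex mat" where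
  "Lambda_mat net k \<Gamma> Y p =
     complex_of_real (weight net (fst p)) \<cdot>\<^sub>m
       (mat_adjoint (direct_chan net k p) * Y p * (1\<^sub>m (streams net (fst p)) + \<Gamma> p))"

definition Psi_mat :: "network \<Rightarrow> mat_family \<Rightarrow> mat_family \<Rightarrow> slot \<Rightarrow> complex mat" where
  "Psi_mat net \<Gamma> Y q = Y q * (1\<^sub>m (streams net (fst q)) + \<Gamma> q) * mat_adjoint (Y q)"

text \<open>The channel \<open>chan_from net k p q\<close> lives on the RBG of \<open>q\<close>, which for
  \<open>q \<in> cochannel net k p\<close> is the RBG of \<open>p\<close>.\<close>

definition L_mat ::
  "network \<Rightarrow> allocation \<Rightarrow> mat_family \<Rightarrow> mat_family \<Rightarrow> slot \<Rightarrow> complex mat" where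
  "L_mat net k \<Gamma> Y p =
     msum (tx_antennas net) (tx_antennas net)
       (\<lambda>q. complex_of_real (weight net (fst q)) \<cdot>\<^sub>m
          (mat_adjoint (chan_from net k p q) * Psi_mat net \<Gamma> Y q * chan_from net k p q))
       (cochannel net k p)"

text \<open>Real parts are taken of the traces so that the function is real-valued for arbitrary
  complex \<open>\<Gamma>\<close> and \<open>Y\<close>; at the auxiliary updates these traces are real.\<close>

definition f_P4 ::
  "network \<Rightarrow> allocation \<Rightarrow> (slot \<Rightarrow> real) \<Rightarrow> mat_family \<Rightarrow> mat_family \<Rightarrow> mat_family
     \<Rightarrow> mat_family \<Rightarrow> real" where
  "f_P4 net k lam V \<Gamma> Y Z =
     (\<Sum>p\<in>active net k.
        let \<rho> = weight net (fst p);
            I\<^sub>d = 1\<^sub>m (streams net (fst p));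
            A = complex_of_real (lam p) \<cdot>\<^sub>m 1\<^sub>m (tx_antennas net) - L_mat net k \<Gamma> Y p
        in \<rho> * logdet (I\<^sub>d + \<Gamma> p)
           - \<rho> * Re (tr (\<Gamma> p))
           - \<rho> * noise_power net * Re (tr (mat_adjoint (Y p) * Y p * (I\<^sub>d + \<Gamma> p)))
           - lam p * Re (tr (mat_adjoint (V p) * V p))
           + 2 * Re (tr (mat_adjoint (V p) * Lambda_mat net k \<Gamma> Y p
                         + mat_adjoint (V p) * A * Z p))
           - Re (tr (mat_adjoint (Z p) * A * Z p)))"


section \<open>Geometry of the beamformer space and stationarity\<close>

definition fam_inner :: "network \<Rightarrow> allocation \<Rightarrow> mat_family \<Rightarrow> mat_family \<Rightarrow> real" where
  "fam_inner net k A B = (\<Sum>p\<in>active net k. Re (tr (mat_adjoint (A p) * B p)))"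

definition fam_norm :: "network \<Rightarrow> allocation \<Rightarrow> mat_family \<Rightarrow> real" where
  "fam_norm net k A = sqrt (fam_inner net k A A)"

definition fam_diff :: "mat_family \<Rightarrow> mat_family \<Rightarrow> mat_family" where
  "fam_diff A B p = A p - B p"

text \<open>\<open>G\<close> is the (Frechet) gradient of \<open>F\<close> at \<open>V\<close> in the real inner product space
  \<open>beam_space net k\<close> with inner product \<open>fam_inner net k\<close>. The library's \<open>GDERIV\<close> needs
  this space to be a type, which the slot-dependent dimensions rule out.\<close>

definition has_gradient ::
  "network \<Rightarrow> allocation \<Rightarrow> (mat_family \<Rightarrow> real) \<Rightarrow> mat_family \<Rightarrow> mat_family \<Rightarrow> bool" where
  "has_gradient net k F V G \<longleftrightarrow>
     G \<in> beam_space net k \<and>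
     (\<forall>\<epsilon>>0. \<exists>\<delta>>0. \<forall>W\<in>beam_space net k.
        fam_norm net k (fam_diff W V) < \<delta> \<longrightarrow>
        \<bar>F W - F V - fam_inner net k G (fam_diff W V)\<bar> \<le> \<epsilon> * fam_norm net k (fam_diff W V))"

text \<open>Admissible parameters \<open>lam\<close> always exist (the active set is finite) and the gradient does
  not depend on them, so quantifying universally over them is harmless.\<close>

definition stationary :: "network \<Rightarrow> allocation \<Rightarrow> mat_family \<Rightarrow> bool" where
  "stationary net k Vs \<longleftrightarrow>
     feasible net k Vs \<and>
     (let \<Gamma>s = Gamma_upd net k Vs; Ys = Y_upd net k Vs; Zs = Vs in
      \<forall>lam. (\<forall>p\<in>active net k. lambda_max (L_mat net k \<Gamma>s Ys p) \<le> lam p) \<longrightarrow>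
        (\<exists>G. has_gradient net k (\<lambda>V. f_P4 net k lam V \<Gamma>s Ys Zs) Vs G \<and>
             (\<forall>V. feasible net k V \<longrightarrow> fam_inner net k G (fam_diff V Vs) \<le> 0)))"

definition accumulation_point ::
  "network \<Rightarrow> allocation \<Rightarrow> (nat \<Rightarrow> mat_family) \<Rightarrow> mat_family \<Rightarrow> bool" where
  "accumulation_point net k X A \<longleftrightarrow>
     A \<in> beam_space net k \<and>
     (\<exists>r :: nat \<Rightarrow> nat. strict_mono r \<and>
        (\<lambda>n. fam_norm net k (fam_diff (X (r n)) A)) \<longlonglongrightarrow> 0)"


section \<open>The iteration\<close>

definition Lambda_at :: "network \<Rightarrow> allocation \<Rightarrow> mat_family \<Rightarrow> slot \<Rightarrow> complex mat" where
  "Lambda_at net k W = Lambda_mat net k (Gamma_upd net k W) (Y_upd net k W)"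

definition L_at :: "network \<Rightarrow> allocation \<Rightarrow> mat_family \<Rightarrow> slot \<Rightarrow> complex mat" where
  "L_at net k W = L_mat net k (Gamma_upd net k W) (Y_upd net k W)"

definition fp_point :: "network \<Rightarrow> allocation \<Rightarrow> real \<Rightarrow> mat_family \<Rightarrow> slot \<Rightarrow> complex mat" where
  "fp_point net k l W p =
     W p + complex_of_real (1 / l) \<cdot>\<^sub>m (Lambda_at net k W p - L_at net k W p * W p)"

definition relaxed_step ::
  "network \<Rightarrow> allocation \<Rightarrow> real \<Rightarrow> real \<Rightarrow> mat_family \<Rightarrow> slot \<Rightarrow> complex mat" where
  "relaxed_step net k l a W p =
     proj_ball (power_budget net)
       (W p + complex_of_real a \<cdot>\<^sub>m (fp_point net k l W p - W p))"

end

theory Submission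
  imports Defs
begin

text \<open>With \<open>\<Gamma>\<close> and \<open>Y\<close> updated at \<open>W\<close>, the fractional programming transforms give a surrogate
  \<open>surr W V\<close> of the rate \<open>f\<close> with \<open>surr W V \<le> f V\<close> and equality at \<open>V = W\<close>: completing the
  square in \<open>Y\<close> reduces the bound to \<open>ln det X \<le> tr X - d\<close>. Minorizing \<open>- tr (V\<^sup>H L V)\<close> with
  \<open>\<lambda> I \<ge> L\<close> leaves in each slot a concave quadratic with maximizer at the unrelaxed update, and
  the projection inequality shows that a relaxed projected step \<open>W \<mapsto> W + \<Delta>\<close> raises it by
  \<open>2 \<langle>\<Delta>, \<Lambda> - L W\<rangle> - \<lambda> \<parallel>\<Delta>\<parallel>\<^sup>2 \<ge> (2 / \<alpha> - 1) \<lambda> \<parallel>\<Delta>\<parallel>\<^sup>2 \<ge> 0\<close>. Hence \<open>f\<close> increases and,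
  being bounded, converges; the raises tend to \<open>0\<close>, so \<open>\<lambda> \<parallel>\<Delta>\<parallel>\<^sup>2\<close> and \<open>\<langle>\<Delta>, \<Lambda> - L W\<rangle>\<close> vanish,
  and the variational inequality characterizing the projection passes to the limit.\<close>

section \<open>The real trace inner product\<close>

text \<open>The obstacle is the coupling of the slots through interference. \<open>L_mat\<close>
  collects, for one transmitter, the leakage into all cochannel receivers, whereas a rate involves
  the interference at one receiver, so the surrogate splits into per-slot transforms only after a
  double sum over cochannel pairs is exchanged. The trace inequality enters through the minimum mean
  square error identity: with \<open>Y0 = minv J * T\<close> the error matrix \<open>1 - K\<close>
  is the inverse of \<open>1 + Gamma\<close>, so the log-determinant of the rate is minus that of
  \<open>1 - K\<close>. The inequality is applied to a product of two positive definite matrices,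
  which need not be Hermitian but still has a positive spectrum. Large values of \<open>lam\<close>
  shorten the steps without limit, so the natural quantity to control is \<open>lam\<close> times
  the squared step; an upper bound on \<open>lam\<close> enters only where the variational
  inequality is passed to the limit.\<close>

lemma sum_Cauchy_Schwarz:
  fixes a b :: "'i \<Rightarrow> real"
  shows "(\<Sum>i\<in>I. a i * b i)\<^sup>2 \<le> (\<Sum>i\<in>I. (a i)\<^sup>2) * (\<Sum>i\<in>I. (b i)\<^sup>2)"
proof (cases "finite I \<and> (\<Sum>i\<in>I. (b i)\<^sup>2) \<noteq> 0")
  case True
  define A B C where "A = (\<Sum>i\<in>I. (a i)\<^sup>2)" "B = (\<Sum>i\<in>I. (b i)\<^sup>2)" "C = (\<Sum>i\<in>I. a i * b i)"
  \<comment> \<open>The vector \<open>B a - C b\<close> is, up to the factor \<open>B\<close>, the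
    part of \<open>a\<close> orthogonal to \<open>b\<close>.\<close>
  have "0 \<le> (\<Sum>i\<in>I. (B * a i - C * b i)\<^sup>2)" by (simp add: sum_nonneg)
  also have "\<dots> = (\<Sum>i\<in>I. B\<^sup>2 * (a i)\<^sup>2 - 2 * B * C * (a i * b i) + C\<^sup>2 * (b i)\<^sup>2)"
    by (rule sum.cong) (auto simp: power2_eq_square algebra_simps)
  also have "\<dots> = B\<^sup>2 * A - 2 * B * C * C + C\<^sup>2 * B"
    by (simp add: A_B_C_def sum.distrib sum_subtractf sum_distrib_left)
  also have "\<dots> = B * (A * B - C\<^sup>2)" by (simp add: power2_eq_square algebra_simps)
  finally have "0 \<le> B * (A * B - C\<^sup>2)" .
  moreover have "B > 0" using True unfolding A_B_C_def by (metis sum_nonneg less_eq_real_def zero_le_power2)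
  ultimately show ?thesis unfolding A_B_C_def[symmetric] by (simp add: zero_le_mult_iff)
next
  case False
  then show ?thesis by (cases "finite I") (auto simp: sum_nonneg_eq_0_iff)
qed

section \<open>Adjoints and traces\<close>

lemma mat_adjoint_index [simp]:
  fixes A :: "complex mat"
  shows "i < dim_col A \<Longrightarrow> j < dim_row A \<Longrightarrow> mat_adjoint A $$ (i, j) = cnj (A $$ (j, i))"
  by (simp add: mat_adjoint_def mat_of_rows_def conjugate_complex_def)

lemma mat_adjoint_dim [simp]:
  "dim_row (mat_adjoint A) = dim_col A" "dim_col (mat_adjoint A) = dim_row A"
  by (simp_all add: mat_adjoint_def)

lemma mat_adjoint_carrier [simp]:
  "mat_adjoint A \<in> carrier_mat n m \<longleftrightarrow> A \<in> carrier_mat m n"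
  by (metis carrier_matI carrier_matD mat_adjoint_dim)

lemma mat_adjoint_adjoint [simp]: "mat_adjoint (mat_adjoint A) = (A :: complex mat)"
  by (rule eq_matI) auto

lemma mat_adjoint_one [simp]: "mat_adjoint (1\<^sub>m n) = (1\<^sub>m n :: complex mat)"
  by (rule eq_matI) auto

lemma mat_adjoint_mult:
  fixes A B :: "complex mat"
  assumes "dim_col A = dim_row B"
  shows "mat_adjoint (A * B) = mat_adjoint B * mat_adjoint A"
  by (rule eq_matI) (use assms in \<open>auto simp: scalar_prod_def mult.commute intro!: sum.cong\<close>)

lemma mat_adjoint_add:
  fixes A B :: "complex mat"
  assumes "A \<in> carrier_mat n m" "B \<in> carrier_mat n m"
  shows "mat_adjoint (A + B) = mat_adjoint A + mat_adjoint B"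
  by (rule eq_matI) (use assms in auto)

lemma mat_adjoint_smult:
  "mat_adjoint (c \<cdot>\<^sub>m A) = cnj c \<cdot>\<^sub>m mat_adjoint A"
  by (rule eq_matI, simp_all)

lemma mat_mult_assoc:
  fixes A B C :: "complex mat"
  assumes "dim_col A = dim_row B" "dim_col B = dim_row C"
  shows "A * B * C = A * (B * C)"
  using assms by (intro assoc_mult_mat) auto

lemma tr_add:
  "A \<in> carrier_mat n n \<Longrightarrow> B \<in> carrier_mat n n \<Longrightarrow> tr (A + B) = tr A + tr B"
  by (simp add: tr_def sum.distrib)

lemma tr_diff:
  "A \<in> carrier_mat n n \<Longrightarrow> B \<in> carrier_mat n n \<Longrightarrow> tr (A - B) = tr A - tr B"
  by (simp add: tr_def sum_subtractf)

lemma tr_smult: "A \<in> carrier_mat n n \<Longrightarrow> tr (c \<cdot>\<^sub>m A) = c * tr A"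
  by (simp add: tr_def sum_distrib_left)

lemma tr_one: "tr (1\<^sub>m n) = of_nat n"
  by (simp add: tr_def)

lemma tr_adjoint: "A \<in> carrier_mat n n \<Longrightarrow> tr (mat_adjoint A) = cnj (tr A)"
  by (simp add: tr_def)

lemma tr_mult_commute:
  assumes "A \<in> carrier_mat n m" "B \<in> carrier_mat m n"
  shows "tr (A * B) = tr (B * A)"
proof -
  have "tr (A * B) = (\<Sum>r<n. \<Sum>c<m. A $$ (r, c) * B $$ (c, r))"
    using assms by (auto simp: tr_def scalar_prod_def atLeast0LessThan)
  also have "\<dots> = (\<Sum>c<m. \<Sum>r<n. A $$ (r, c) * B $$ (c, r))" by (rule sum.swap)
  also have "\<dots> = tr (B * A)"
    using assms by (auto simp: tr_def scalar_prod_def atLeast0LessThan mult.commute)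
  finally show ?thesis .
qed

text \<open>The Frobenius inner product on complex matrices regarded as a real vector space.
  \<open>frob_norm\<close> is its norm and \<open>fam_inner\<close> its sum over the active
  slots.\<close>

definition mip :: "complex mat \<Rightarrow> complex mat \<Rightarrow> real" where
  "mip A B = Re (tr (mat_adjoint A * B))"

lemma mip_expand:
  assumes "A \<in> carrier_mat n m" "B \<in> carrier_mat n m"
  shows "mip A B = (\<Sum>(i, j)\<in>{..<n} \<times> {..<m}. Re (cnj (A $$ (i, j)) * B $$ (i, j)))"
proof -
  have "mip A B = (\<Sum>j<m. \<Sum>i<n. Re (cnj (A $$ (i, j)) * B $$ (i, j)))"
    using assms by (auto simp: mip_def tr_def scalar_prod_def atLeast0LessThan intro!: sum.cong)
  also have "\<dots> = (\<Sum>i<n. \<Sum>j<m. Re (cnj (A $$ (i, j)) * B $$ (i, j)))"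
    by (rule sum.swap)
  finally show ?thesis by (simp only: sum.cartesian_product)
qed

lemma mip_commute:
  assumes "A \<in> carrier_mat n m" "B \<in> carrier_mat n m"
  shows "mip A B = mip B A"
  unfolding mip_expand[OF assms] mip_expand[OF assms(2,1)] by (rule sum.cong) auto

lemma mip_add_right:
  assumes "A \<in> carrier_mat n m" "B \<in> carrier_mat n m" "C \<in> carrier_mat n m"
  shows "mip A (B + C) = mip A B + mip A C"
proof -
  have BC: "B + C \<in> carrier_mat n m" using assms by auto
  show ?thesis
    unfolding mip_expand[OF assms(1,2)] mip_expand[OF assms(1,3)] mip_expand[OF assms(1) BC]
      sum.distrib[symmetric]
    by (rule sum.cong) (use assms in \<open>auto simp: algebra_simps\<close>)
qed

lemma mip_diff_right:
  assumes "A \<in> carrier_mat n m" "B \<in> carrier_mat n m" "C \<in> carrier_mat n m"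
  shows "mip A (B - C) = mip A B - mip A C"
proof -
  have BC: "B - C \<in> carrier_mat n m" using assms by auto
  show ?thesis
    unfolding mip_expand[OF assms(1,2)] mip_expand[OF assms(1,3)] mip_expand[OF assms(1) BC]
      sum_subtractf[symmetric]
    by (rule sum.cong) (use assms in \<open>auto simp: algebra_simps\<close>)
qed

lemma mip_smult_right:
  assumes "A \<in> carrier_mat n m" "B \<in> carrier_mat n m"
  shows "mip A (complex_of_real c \<cdot>\<^sub>m B) = c * mip A B"
proof -
  have cB: "complex_of_real c \<cdot>\<^sub>m B \<in> carrier_mat n m" using assms by auto
  show ?thesis
    unfolding mip_expand[OF assms] mip_expand[OF assms(1) cB] sum_distrib_left
    by (rule sum.cong) (use assms in \<open>auto simp: algebra_simps\<close>)
qed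

lemma mip_add_left:
  assumes "A \<in> carrier_mat n m" "B \<in> carrier_mat n m" "C \<in> carrier_mat n m"
  shows "mip (A + B) C = mip A C + mip B C"
  using mip_add_right[OF assms(3,1,2)] assms
  by (simp add: mip_commute[of _ n m C])

lemma mip_diff_left:
  assumes "A \<in> carrier_mat n m" "B \<in> carrier_mat n m" "C \<in> carrier_mat n m"
  shows "mip (A - B) C = mip A C - mip B C"
  using mip_diff_right[OF assms(3,1,2)] assms
  by (simp add: mip_commute[of _ n m C] minus_carrier_mat)

lemma mip_smult_left:
  assumes "A \<in> carrier_mat n m" "B \<in> carrier_mat n m"
  shows "mip (complex_of_real c \<cdot>\<^sub>m A) B = c * mip A B"
  using mip_smult_right[OF assms(2,1)] assms by (simp add: mip_commute[of _ n m B])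

lemma mip_self:
  "mip A A = (\<Sum>(i, j)\<in>{..<dim_row A} \<times> {..<dim_col A}. (cmod (A $$ (i, j)))\<^sup>2)"
proof -
  have A: "A \<in> carrier_mat (dim_row A) (dim_col A)" by simp
  show ?thesis unfolding mip_expand[OF A A]
    by (rule sum.cong) (auto simp only: split: prod.splits, subst cmod_power2, simp add: power2_eq_square)
qed

lemma mip_self_nonneg: "0 \<le> mip A A"
  by (auto simp: mip_self intro!: sum_nonneg)

lemma frob_norm_eq: "frob_norm A = sqrt (mip A A)"
  by (simp add: frob_norm_def mip_self sum.cartesian_product)

lemma mip_self_pos:
  assumes "A \<in> carrier_mat n m" "A \<noteq> 0\<^sub>m n m"
  shows "0 < mip A A"
proof (rule ccontr)
  assume "\<not> 0 < mip A A"
  then have "mip A A = 0" using mip_self_nonneg[of A] by simp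
  then have "\<forall>x\<in>{..<n} \<times> {..<m}. (case x of (i, j) \<Rightarrow> (cmod (A $$ (i, j)))\<^sup>2) = 0"
    using assms(1) by (subst (asm) mip_self, subst (asm) sum_nonneg_eq_0_iff) auto
  then have "A = 0\<^sub>m n m" using assms(1) by (intro eq_matI) auto
  then show False using assms(2) by simp
qed

lemma cmod_le_mip:
  assumes "i < dim_row A" "j < dim_col A"
  shows "(cmod (A $$ (i, j)))\<^sup>2 \<le> mip A A"
proof -
  have "(\<Sum>(i, j)\<in>{(i, j)}. (cmod (A $$ (i, j)))\<^sup>2) \<le> mip A A"
    unfolding mip_self using assms by (intro sum_mono2) auto
  then show ?thesis by simp
qed

lemma mip_Cauchy_Schwarz:
  assumes "A \<in> carrier_mat n m" "B \<in> carrier_mat n m"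
  shows "(mip A B)\<^sup>2 \<le> mip A A * mip B B"
proof -
  have "\<bar>mip A B\<bar> \<le> (\<Sum>(i, j)\<in>{..<n} \<times> {..<m}. cmod (A $$ (i, j)) * cmod (B $$ (i, j)))"
    unfolding mip_expand[OF assms] case_prod_unfold
    by (rule order.trans[OF sum_abs], rule sum_mono)
       (metis abs_Re_le_cmod complex_mod_cnj norm_mult)
  then have "(mip A B)\<^sup>2 \<le> (\<Sum>(i, j)\<in>{..<n} \<times> {..<m}. cmod (A $$ (i, j)) * cmod (B $$ (i, j)))\<^sup>2"
    using power_mono[of "\<bar>mip A B\<bar>" _ 2] by simp
  also have "\<dots> \<le> mip A A * mip B B"
    using sum_Cauchy_Schwarz[of "\<lambda>x. cmod (A $$ x)" "\<lambda>x. cmod (B $$ x)" "{..<n} \<times> {..<m}"] assms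
    by (simp add: mip_self case_prod_unfold)
  finally show ?thesis .
qed

text \<open>Submultiplicativity of the Frobenius norm, by Cauchy-Schwarz in each entry of the
  product. It bounds quadratic forms and the received signal power.\<close>

lemma mip_mult_self_le:
  assumes A: "A \<in> carrier_mat n m" and X: "X \<in> carrier_mat m l"
  shows "mip (A * X) (A * X) \<le> mip A A * mip X X"
proof -
  have "(cmod ((A * X) $$ (i, j)))\<^sup>2 \<le>
      (\<Sum>k<m. (cmod (A $$ (i, k)))\<^sup>2) * (\<Sum>k<m. (cmod (X $$ (k, j)))\<^sup>2)"
    if "i < n" "j < l" for i j
  proof -
    have "cmod ((A * X) $$ (i, j)) \<le> (\<Sum>k<m. cmod (A $$ (i, k)) * cmod (X $$ (k, j)))"
      using A X that
      by (auto simp: scalar_prod_def atLeast0LessThan norm_mult[symmetric] intro!: order.trans[OF norm_sum])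
    then have "(cmod ((A * X) $$ (i, j)))\<^sup>2 \<le> (\<Sum>k<m. cmod (A $$ (i, k)) * cmod (X $$ (k, j)))\<^sup>2"
      by (rule power_mono) simp
    also note sum_Cauchy_Schwarz
    finally show ?thesis .
  qed
  then have "mip (A * X) (A * X) \<le> (\<Sum>(i, j)\<in>{..<n} \<times> {..<l}.
      (\<Sum>k<m. (cmod (A $$ (i, k)))\<^sup>2) * (\<Sum>k<m. (cmod (X $$ (k, j)))\<^sup>2))"
    unfolding mip_self using A X by (auto intro!: sum_mono)
  also have "\<dots> = (\<Sum>i<n. \<Sum>k<m. (cmod (A $$ (i, k)))\<^sup>2) * (\<Sum>j<l. \<Sum>k<m. (cmod (X $$ (k, j)))\<^sup>2)"
    by (simp add: sum.cartesian_product[symmetric] sum_product)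
  also have "\<dots> = mip A A * mip X X"
    using A X by (subst (2) sum.swap) (simp add: mip_self sum.cartesian_product)
  finally show ?thesis .
qed

lemma mip_mult_left:
  assumes "A \<in> carrier_mat n m" "X \<in> carrier_mat m l" "Y \<in> carrier_mat n l"
  shows "mip (A * X) Y = mip X (mat_adjoint A * Y)"
  using assms by (simp add: mip_def mat_adjoint_mult mat_mult_assoc)

lemma mip_mult_right:
  assumes "X \<in> carrier_mat n m" "Y \<in> carrier_mat n l" "S \<in> carrier_mat l m"
  shows "mip X (Y * S) = mip (X * mat_adjoint S) Y"
proof -
  have "tr (mat_adjoint X * (Y * S)) = tr ((mat_adjoint X * Y) * S)"
    using assms by (simp add: mat_mult_assoc)
  also have "\<dots> = tr (S * (mat_adjoint X * Y))"
    by (rule tr_mult_commute) (use assms in auto)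
  finally show ?thesis using assms by (simp add: mip_def mat_adjoint_mult mat_mult_assoc)
qed

lemma mip_adjoint:
  assumes "A \<in> carrier_mat n m" "B \<in> carrier_mat n m"
  shows "mip (mat_adjoint A) (mat_adjoint B) = mip A B"
  using assms tr_mult_commute[of A n m "mat_adjoint B"]
  by (simp add: mip_commute[OF assms]) (simp add: mip_def)

section \<open>Sums of matrices\<close>

lemma mip_msum:
  assumes "finite I" "\<And>x. x \<in> I \<Longrightarrow> A x \<in> carrier_mat n m" "X \<in> carrier_mat n l" "Z \<in> carrier_mat m l"
  shows "mip X (msum n m A I * Z) = (\<Sum>x\<in>I. mip X (A x * Z))"
  using assms(1,2)
proof (induction I rule: finite_induct)
  case empty
  have "msum n m A {} * Z = 0\<^sub>m n l" using assms(4)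
    by (intro eq_matI) (auto simp: msum_def scalar_prod_def)
  then show ?case using assms(3) by (simp add: mip_def tr_def msum_def)
next
  case (insert y I)
  have "msum n m A (insert y I) = A y + msum n m A I"
    using insert by (intro eq_matI) (auto simp: msum_def)
  moreover have "msum n m A I \<in> carrier_mat n m" by (simp add: msum_def)
  ultimately show ?case using insert assms
    by (simp add: add_mult_distrib_mat[of _ n m] mip_add_right[of _ n l]
        mult_carrier_mat[of _ n m _ l])
qed

lemma msum_carrier [simp]: "msum n m A I \<in> carrier_mat n m"
  by (simp add: msum_def)

lemma msum_hermitian:
  assumes "\<And>x. x \<in> I \<Longrightarrow> A x \<in> carrier_mat n n" "\<And>x. x \<in> I \<Longrightarrow> mat_adjoint (A x) = A x"
  shows "mat_adjoint (msum n n A I) = msum n n A I"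
proof (rule eq_matI)
  fix i j assume ij: "i < dim_row (msum n n A I)" "j < dim_col (msum n n A I)"
  have "cnj (A x $$ (j, i)) = A x $$ (i, j)" if "x \<in> I" for x
  proof -
    have "mat_adjoint (A x) $$ (i, j) = cnj (A x $$ (j, i))"
      using assms(1)[OF that] ij by (intro mat_adjoint_index) (auto simp: msum_def)
    then show ?thesis using assms(2)[OF that] by simp
  qed
  then show "mat_adjoint (msum n n A I) $$ (i, j) = msum n n A I $$ (i, j)"
    using ij by (simp add: msum_def)
qed (auto simp: msum_def)

section \<open>Hermitian forms\<close>

declare minus_carrier_mat [simp]

text \<open>The form is tested on matrices of every width and not on vectors, so that it applies to
  beamformers and receivers without splitting them into columns.\<close>

definition posdef :: "nat \<Rightarrow> complex mat \<Rightarrow> bool" where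
  "posdef n A \<longleftrightarrow> A \<in> carrier_mat n n \<and> mat_adjoint A = A \<and>
     (\<forall>m. \<forall>X\<in>carrier_mat n m. X \<noteq> 0\<^sub>m n m \<longrightarrow> 0 < mip X (A * X))"

lemma posdefD:
  assumes "posdef n A"
  shows "A \<in> carrier_mat n n" "mat_adjoint A = A"
    "X \<in> carrier_mat n m \<Longrightarrow> X \<noteq> 0\<^sub>m n m \<Longrightarrow> 0 < mip X (A * X)"
  using assms by (auto simp: posdef_def)

lemma posdefI:
  assumes "A \<in> carrier_mat n n" "mat_adjoint A = A"
    "\<And>m X. X \<in> carrier_mat n m \<Longrightarrow> X \<noteq> 0\<^sub>m n m \<Longrightarrow> 0 < mip X (A * X)"
  shows "posdef n A"
  using assms by (auto simp: posdef_def)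

lemma mip_zero_right: "X \<in> carrier_mat n m \<Longrightarrow> mip X (0\<^sub>m n m) = 0"
  by (simp add: mip_def tr_def)

text \<open>The Frobenius norm serves as a crude bound on the spectrum. It yields a first dominating
  constant for a form and controls the form of an inverse in the eigenvalue argument.\<close>

lemma mip_quadratic_le:
  assumes "A \<in> carrier_mat n n" "X \<in> carrier_mat n m"
  shows "mip X (A * X) \<le> sqrt (mip A A) * mip X X"
proof -
  have AX: "A * X \<in> carrier_mat n m" using assms by auto
  have "(mip X (A * X))\<^sup>2 \<le> mip X X * mip (A * X) (A * X)"
    by (rule mip_Cauchy_Schwarz[OF assms(2) AX])
  also have "\<dots> \<le> mip X X * (mip A A * mip X X)"
    by (intro mult_left_mono mip_mult_self_le[OF assms] mip_self_nonneg)
  also have "\<dots> = (sqrt (mip A A) * mip X X)\<^sup>2"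
    using mip_self_nonneg[of A] by (simp add: power_mult_distrib power2_eq_square[of "mip X X"])
  finally have "(mip X (A * X))\<^sup>2 \<le> (sqrt (mip A A) * mip X X)\<^sup>2" .
  then have "\<bar>mip X (A * X)\<bar> \<le> sqrt (mip A A) * mip X X"
    using mip_self_nonneg by (subst (asm) abs_le_square_iff[symmetric]) (simp add: abs_mult)
  then show ?thesis by simp
qed

text \<open>The product is Hermitian, so its trace equals its own conjugate. This upgrades the real
  part in \<open>mip\<close> to an equation of complex numbers, which can be solved for an
  eigenvalue.\<close>

lemma tr_quadratic_real:
  assumes "A \<in> carrier_mat n n" "mat_adjoint A = A" "X \<in> carrier_mat n m"
  shows "tr (mat_adjoint X * (A * X)) = complex_of_real (mip X (A * X))"
proof -
  have "cnj (tr (mat_adjoint X * (A * X))) = tr (mat_adjoint (mat_adjoint X * (A * X)))"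
    by (rule tr_adjoint[symmetric]) (use assms in auto)
  also have "mat_adjoint (mat_adjoint X * (A * X)) = mat_adjoint X * (A * X)"
    using assms by (simp add: mat_adjoint_mult mat_mult_assoc)
  finally show ?thesis
    by (simp add: mip_def complex_eq_iff)
qed

section \<open>Kernels and inverses\<close>

lemma mat_kernel_witness:
  fixes A :: "complex mat"
  assumes A: "A \<in> carrier_mat n n" and "det A = 0"
  shows "\<exists>X\<in>carrier_mat n 1. X \<noteq> 0\<^sub>m n 1 \<and> A * X = 0\<^sub>m n 1"
proof -
  obtain v where v: "v \<in> carrier_vec n" "v \<noteq> 0\<^sub>v n" "A *\<^sub>v v = 0\<^sub>v n"
    using det_0_iff_vec_prod_zero[OF A] assms(2) by auto
  define X where "X = mat n 1 (\<lambda>(i, j). v $ i)"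
  have col: "col X 0 = v" using v(1) by (auto simp: X_def)
  have "A * X = 0\<^sub>m n 1"
  proof (rule eq_matI)
    fix i j assume "i < dim_row (0\<^sub>m n 1 :: complex mat)" "j < dim_col (0\<^sub>m n 1 :: complex mat)"
    then show "(A * X) $$ (i, j) = 0\<^sub>m n 1 $$ (i, j)"
      using A col v(3) by (auto simp: X_def index_mult_mat_vec[symmetric] simp del: index_mult_mat_vec)
  qed (use A in \<open>auto simp: X_def\<close>)
  moreover have "X \<noteq> 0\<^sub>m n 1"
  proof
    assume "X = 0\<^sub>m n 1"
    then have "v = 0\<^sub>v n" using col v(1) by (metis col_zero less_numeral_extra(1))
    then show False using v(2) by simp
  qed
  ultimately show ?thesis by (intro bexI[of _ X]) (auto simp: X_def)
qed

lemma posdef_det_nonzero: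
  assumes "posdef n A"
  shows "det A \<noteq> 0"
proof
  assume "det A = 0"
  then obtain X where X: "X \<in> carrier_mat n 1" "X \<noteq> 0\<^sub>m n 1" "A * X = 0\<^sub>m n 1"
    using mat_kernel_witness posdefD(1)[OF assms] by blast
  have "0 < mip X (A * X)" by (rule posdefD(3)[OF assms X(1,2)])
  then show False using X by (simp add: mip_def tr_def)
qed

lemma minv:
  assumes A: "A \<in> carrier_mat n n" and "det A \<noteq> 0"
  shows "A * minv A = 1\<^sub>m n" "minv A * A = 1\<^sub>m n" "minv A \<in> carrier_mat n n"
proof -
  obtain B where "mat_inverse A = Some B"
    \<comment> \<open>The ring of matrices has a free extension field; both facts are taken at the
      same value \<open>()\<close>.\<close>
    using mat_inverse(1)[OF A, where b = "()"] det_non_zero_imp_unit[OF assms, of "()"] by (cases "mat_inverse A") auto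
  then show "A * minv A = 1\<^sub>m n" "minv A * A = 1\<^sub>m n" "minv A \<in> carrier_mat n n"
    using mat_inverse(2)[OF A] by (auto simp: minv_def)
qed

lemma minv_hermitian:
  assumes A: "A \<in> carrier_mat n n" and d: "det A \<noteq> 0" and h: "mat_adjoint A = A"
  shows "mat_adjoint (minv A) = minv A"
proof -
  note i = minv[OF A d]
  have "mat_adjoint (minv A) * A = 1\<^sub>m n"
    using arg_cong[OF i(1), of mat_adjoint] A i(3) h by (simp add: mat_adjoint_mult)
  then have "mat_adjoint (minv A) * A * minv A = minv A" using i by simp
  moreover have "mat_adjoint (minv A) * A * minv A = mat_adjoint (minv A)"
    using A i by (subst mat_mult_assoc) auto
  ultimately show ?thesis by simp
qed

text \<open>Since \<open>A * (B * X) = X\<close>, the form of \<open>B\<close> at \<open>X\<close>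
  is the form of \<open>A\<close> at \<open>B * X\<close>.\<close>

lemma posdef_inverse:
  assumes A: "posdef n A" and B: "B \<in> carrier_mat n n" and AB: "A * B = 1\<^sub>m n"
  shows "posdef n B"
proof -
  note A' = posdefD[OF A]
  have BA: "B * A = 1\<^sub>m n" using mat_mult_left_right_inverse[OF A'(1) B AB] .
  have "mat_adjoint B * A = 1\<^sub>m n"
    using arg_cong[OF AB, of mat_adjoint] A' B by (simp add: mat_adjoint_mult)
  then have "mat_adjoint B * A * B = B" using B by simp
  moreover have "mat_adjoint B * A * B = mat_adjoint B"
    using A' B AB by (subst mat_mult_assoc) auto
  ultimately have h: "mat_adjoint B = B" by simp
  have "0 < mip X (B * X)" if X: "X \<in> carrier_mat n m" "X \<noteq> 0\<^sub>m n m" for X m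
  proof -
    have BX: "B * X \<in> carrier_mat n m" using B X by auto
    have e: "A * (B * X) = X" using A' B X AB by (subst mat_mult_assoc[symmetric]) auto
    then have "B * X \<noteq> 0\<^sub>m n m" using X A'(1) by auto
    then have "0 < mip (B * X) (A * (B * X))" by (rule A'(3)[OF BX])
    then show ?thesis using e mip_commute[OF BX X(1)] by simp
  qed
  then show ?thesis using B h by (auto simp: posdef_def)
qed

lemma posdef_one: "posdef n (1\<^sub>m n)"
  by (auto simp: posdef_def mip_self_pos)

section \<open>The largest eigenvalue as a bound on the Hermitian form\<close>

lemma shift_mult_vec:
  fixes A :: "complex mat"
  assumes "A \<in> carrier_mat n n" "v \<in> carrier_vec n"
  shows "(c \<cdot>\<^sub>m 1\<^sub>m n - A) *\<^sub>v v = c \<cdot>\<^sub>v v - A *\<^sub>v v"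
proof -
  have "(c \<cdot>\<^sub>m 1\<^sub>m n) *\<^sub>v v = c \<cdot>\<^sub>v v"
    using assms(2) by (intro eq_vecI) (auto simp: scalar_prod_def if_distrib if_distribR cong: if_cong)
  then show ?thesis using assms by (subst minus_mult_distrib_mat_vec[of _ n n]) auto
qed

lemma mip_shift:
  assumes "A \<in> carrier_mat n n" "X \<in> carrier_mat n m" "Z \<in> carrier_mat n m"
  shows "mip X ((complex_of_real t \<cdot>\<^sub>m 1\<^sub>m n - A) * Z) = t * mip X Z - mip X (A * Z)"
proof -
  have "(complex_of_real t \<cdot>\<^sub>m 1\<^sub>m n - A) * Z = complex_of_real t \<cdot>\<^sub>m Z - A * Z"
    using assms by (subst minus_mult_distrib_mat[of _ n n _ _ m])
      (auto simp: mult_smult_assoc_mat[of _ n n _ m])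
  then show ?thesis using assms
    by (simp add: mip_diff_right[of _ n m] mip_smult_right[of _ n m] mult_carrier_mat[of _ n n _ m])
qed

text \<open>The least \<open>t\<close> for which \<open>t I - A\<close> is positive semidefinite is an eigenvalue of \<open>A\<close>:
  were \<open>t I - A\<close> invertible, its form would be bounded below by a positive multiple of the
  squared norm and \<open>t\<close> could be decreased.\<close>

lemma mip_le_lambda_max:
  assumes A: "A \<in> carrier_mat n n" and h: "mat_adjoint A = A"
    and le: "lambda_max A \<le> l" and X: "X \<in> carrier_mat n m"
  shows "mip X (A * X) \<le> l * mip X X"
proof (cases "n = 0")
  \<comment> \<open>Without eigenvalues \<open>lambda_max\<close> is a \<open>Max\<close> of the
    empty set, but both inner products are empty sums.\<close>
  case True
  then show ?thesis using X A by (simp add: mip_expand[of _ 0 m] mult_carrier_mat[of _ 0 0 _ m])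
next
  case False
  define T where "T = {t. \<forall>m. \<forall>X\<in>carrier_mat n m. mip X (A * X) \<le> t * mip X X}"
  define t0 where "t0 = Inf T"
  have ne: "T \<noteq> {}"
    using mip_quadratic_le[OF A] by (auto simp: T_def)
  \<comment> \<open>The identity is a test matrix of positive norm; dividing by that norm bounds
    \<open>T\<close> from below.\<close>
  have one: "0 < mip (1\<^sub>m n) (1\<^sub>m n)"
    using False by (intro mip_self_pos[of _ n n]) (auto dest!: arg_cong[of _ _ "\<lambda>A. A $$ (0, 0)"])
  have bdd: "bdd_below T"
  proof (rule bdd_belowI)
    fix t assume "t \<in> T"
    then have "\<forall>X\<in>carrier_mat n n. mip X (A * X) \<le> t * mip X X" by (simp add: T_def)
    then have "mip (1\<^sub>m n) (A * 1\<^sub>m n) \<le> t * mip (1\<^sub>m n) (1\<^sub>m n)" by (rule bspec) simp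
    then show "mip (1\<^sub>m n) (A * 1\<^sub>m n) / mip (1\<^sub>m n) (1\<^sub>m n) \<le> t"
      using one by (simp add: field_simps)
  qed
  have t0: "mip X (A * X) \<le> t0 * mip X X" if X: "X \<in> carrier_mat n m" for X m
  proof (cases "mip X X = 0")
    case True
    then show ?thesis using ne X unfolding T_def by force
  next
    case False
    then have p: "mip X X > 0" using mip_self_nonneg[of X] by simp
    have "mip X (A * X) / mip X X \<le> t0" unfolding t0_def
      using p X by (intro cInf_greatest[OF ne]) (auto simp: T_def field_simps)
    then show ?thesis using p by (simp add: field_simps)
  qed
  define B0 where "B0 = complex_of_real t0 \<cdot>\<^sub>m 1\<^sub>m n - A"
  have B0: "B0 \<in> carrier_mat n n" using A by (auto simp: B0_def)
  have hB0: "mat_adjoint B0 = B0"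
  proof (rule eq_matI)
    fix i j assume "i < dim_row B0" "j < dim_col B0"
    then have ij: "i < n" "j < n" using B0 by auto
    have "cnj (A $$ (j, i)) = A $$ (i, j)" using h A ij mat_adjoint_index[of i A j] by auto
    then show "mat_adjoint B0 $$ (i, j) = B0 $$ (i, j)" using ij A by (auto simp: B0_def)
  qed (use B0 in auto)
  have "det B0 = 0"
  proof (rule ccontr)
    assume "det B0 \<noteq> 0"
    then obtain B where B: "B \<in> carrier_mat n n" "B0 * B = 1\<^sub>m n" using minv[OF B0] by blast
    \<comment> \<open>\<open>K\<close> dominates the form of the inverse \<open>B\<close> of
      \<open>B0\<close>; the added 1 makes it positive.\<close>
    define K where "K = sqrt (mip B B) + 1"
    have K: "K > 0" using mip_self_nonneg[of B] by (simp add: K_def add_nonneg_pos)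
    have "mip X (A * X) \<le> (t0 - 1 / K) * mip X X" if X: "X \<in> carrier_mat n m" for X m
    proof -
      define Z where "Z = B * X"
      have Z: "Z \<in> carrier_mat n m" using B X by (auto simp: Z_def)
      have B0Z: "B0 * Z = X" unfolding Z_def using B B0 X by (subst mat_mult_assoc[symmetric]) auto
      define s where "s = 1 / K"
      have sZ: "complex_of_real s \<cdot>\<^sub>m Z \<in> carrier_mat n m" using Z by auto
      have B0sZ: "B0 * (complex_of_real s \<cdot>\<^sub>m Z) = complex_of_real s \<cdot>\<^sub>m X"
        using B0Z B0 Z by (simp add: mult_smult_distrib[of _ n n _ m])
      have B0X: "B0 * X \<in> carrier_mat n m" using B0 X by auto
      \<comment> \<open>As \<open>B0 * Z = X\<close>, the nonnegative form of \<open>B0\<close> at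
        \<open>X - s Z\<close> equals \<open>mip X (B0 * X) - 2 s mip X X + s^2 mip Z X\<close>.
        With \<open>mip Z X <= K mip X X\<close> and \<open>s = 1 / K\<close> this gives the lower
        bound \<open>s mip X X\<close>, without a square root of \<open>B0\<close>.\<close>
      define W where "W = X - complex_of_real s \<cdot>\<^sub>m Z"
      have W: "W \<in> carrier_mat n m" using X Z by (auto simp: W_def)
      have ZX: "mip Z X \<le> K * mip X X"
        using mip_quadratic_le[OF B(1) X] mip_commute[OF Z X] mip_self_nonneg[of X]
        by (simp add: Z_def K_def algebra_simps)
      have ZBX: "mip Z (B0 * X) = mip X X"
        using mip_mult_left[OF B0 Z X] hB0 B0Z by simp
      have "0 \<le> mip W (B0 * W)"
        using mip_shift[OF A W W, of t0] t0[OF W] by (simp add: B0_def)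
      also have "B0 * W = B0 * X - complex_of_real s \<cdot>\<^sub>m X"
        unfolding W_def using mult_minus_distrib_mat[OF B0 X sZ] B0sZ by simp
      also have "mip W \<dots> = mip X (B0 * X) - s * mip X X - (s * mip X X - s * (s * mip Z X))"
        unfolding W_def using X Z B0X sZ
        by (simp add: mip_diff_left[of _ n m] mip_diff_right[of _ n m] mip_smult_left[of _ n m]
            mip_smult_right[of _ n m] ZBX algebra_simps)
      also have "\<dots> \<le> mip X (B0 * X) - s * mip X X"
        using mult_left_mono[OF ZX, of "s * s"] K by (simp add: s_def field_simps)
      finally have "1 / K * mip X X \<le> mip X (B0 * X)" by (simp add: s_def)
      then show ?thesis using mip_shift[OF A X X, of t0] by (simp add: B0_def algebra_simps)
    qed
    then have "t0 - 1 / K \<in> T" by (auto simp: T_def)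
    then have "t0 \<le> t0 - 1 / K" unfolding t0_def using bdd by (intro cInf_lower)
    then show False using K by simp
  qed
  then obtain v where v: "v \<in> carrier_vec n" "v \<noteq> 0\<^sub>v n" "B0 *\<^sub>v v = 0\<^sub>v n"
    using det_0_iff_vec_prod_zero[OF B0] by auto
  have "A *\<^sub>v v = complex_of_real t0 \<cdot>\<^sub>v v"
  proof (rule eq_vecI)
    fix i assume i: "i < dim_vec (complex_of_real t0 \<cdot>\<^sub>v v)"
    have "B0 *\<^sub>v v = complex_of_real t0 \<cdot>\<^sub>v v - A *\<^sub>v v"
      unfolding B0_def by (rule shift_mult_vec[OF A v(1)])
    then have "(complex_of_real t0 \<cdot>\<^sub>v v - A *\<^sub>v v) $ i = 0\<^sub>v n $ i" using v(3) by simp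
    then show "(A *\<^sub>v v) $ i = (complex_of_real t0 \<cdot>\<^sub>v v) $ i"
      using i v(1) A by simp
  qed (use A v in auto)
  then have ev: "eigenvalue A (complex_of_real t0)"
    using v A by (auto simp: eigenvalue_def eigenvector_def)
  have "finite {x. eigenvalue A (complex_of_real x)}"
  proof -
    have "char_poly A \<noteq> 0" using degree_monic_char_poly[OF A] by auto
    then have "finite {z. poly (char_poly A) z = 0}" by (rule poly_roots_finite)
    then have "finite (complex_of_real -` {z. poly (char_poly A) z = 0})"
      by (rule finite_vimageI) (simp add: inj_on_def)
    then show ?thesis using eigenvalue_root_char_poly[OF A] by (simp add: vimage_def)
  qed
  then have "t0 \<le> lambda_max A" unfolding lambda_max_def using ev by (intro Max_ge) auto
  then have "t0 * mip X X \<le> l * mip X X" using le mip_self_nonneg by (intro mult_right_mono) auto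
  then show ?thesis using t0[OF X] by simp
qed

section \<open>Determinants of positive definite matrices\<close>

text \<open>For an eigenmatrix \<open>X\<close> and \<open>Z = B * X\<close>, pairing
  \<open>S * Z = \<mu> X\<close> with \<open>Z\<close> gives
  \<open>mip Z (S * Z) = \<mu> mip X (B * X)\<close>, so \<mu> is a quotient of two positive
  forms.\<close>

lemma posdef_mult_eigenvalue:
  assumes S: "posdef n S" and B: "posdef n B" and ev: "eigenvalue (S * B) \<mu>"
  shows "\<exists>r>0. \<mu> = complex_of_real r"
proof -
  note S' = posdefD[OF S] and B' = posdefD[OF B]
  have SB: "S * B \<in> carrier_mat n n" using S' B' by auto
  \<comment> \<open>The detour through a vanishing determinant turns the eigenvector into a
    one-column matrix.\<close>
  have "det (\<mu> \<cdot>\<^sub>m 1\<^sub>m n - S * B) = 0"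
  proof -
    obtain v where v: "v \<in> carrier_vec n" "v \<noteq> 0\<^sub>v n" "(S * B) *\<^sub>v v = \<mu> \<cdot>\<^sub>v v"
      using ev SB by (auto simp: eigenvalue_def eigenvector_def)
    have "(\<mu> \<cdot>\<^sub>m 1\<^sub>m n - S * B) *\<^sub>v v = \<mu> \<cdot>\<^sub>v v - (S * B) *\<^sub>v v"
      by (rule shift_mult_vec[OF SB v(1)])
    also have "\<dots> = 0\<^sub>v n" using v by simp
    finally have "(\<mu> \<cdot>\<^sub>m 1\<^sub>m n - S * B) *\<^sub>v v = 0\<^sub>v n" .
    then show ?thesis
      using v SB by (subst det_0_iff_vec_prod_zero[of _ n]) (auto intro!: exI[of _ v])
  qed
  then obtain X where X: "X \<in> carrier_mat n 1" "X \<noteq> 0\<^sub>m n 1"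
    and "(\<mu> \<cdot>\<^sub>m 1\<^sub>m n - S * B) * X = 0\<^sub>m n 1"
    using mat_kernel_witness[of "\<mu> \<cdot>\<^sub>m 1\<^sub>m n - S * B" n] SB by auto
  then have "\<mu> \<cdot>\<^sub>m X - S * B * X = 0\<^sub>m n 1"
    using SB by (subst (asm) minus_mult_distrib_mat[of _ n n _ _ 1])
      (auto simp: mult_smult_assoc_mat[of _ n n _ 1])
  then have e: "S * (B * X) = \<mu> \<cdot>\<^sub>m X"
  proof -
    assume z: "\<mu> \<cdot>\<^sub>m X - S * B * X = 0\<^sub>m n 1"
    have "S * B * X = \<mu> \<cdot>\<^sub>m X"
    proof (rule eq_matI)
      fix i j assume ij: "i < dim_row (\<mu> \<cdot>\<^sub>m X)" "j < dim_col (\<mu> \<cdot>\<^sub>m X)"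
      have "(\<mu> \<cdot>\<^sub>m X - S * B * X) $$ (i, j) = 0" using z ij X by simp
      moreover have "S * B * X \<in> carrier_mat n 1" using SB X by simp
      ultimately show "(S * B * X) $$ (i, j) = (\<mu> \<cdot>\<^sub>m X) $$ (i, j)"
        using ij X by (simp del: index_mult_mat)
    qed (use SB X in auto)
    then show ?thesis using S' B' X by (simp add: mat_mult_assoc)
  qed
  define Z where "Z = B * X"
  have Z: "Z \<in> carrier_mat n 1" using B' X by (auto simp: Z_def)
  have b: "0 < mip X (B * X)" by (rule B'(3)[OF X])
  have "Z \<noteq> 0\<^sub>m n 1" using b mip_zero_right[OF X(1)] by (auto simp: Z_def)
  then have s: "0 < mip Z (S * Z)" by (rule S'(3)[OF Z])
  have "complex_of_real (mip Z (S * Z)) = tr (mat_adjoint Z * (S * Z))"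
    using tr_quadratic_real[OF S'(1,2) Z] by simp
  also have "\<dots> = tr (mat_adjoint Z * (\<mu> \<cdot>\<^sub>m X))" using e by (simp add: Z_def)
  also have "\<dots> = \<mu> * tr (mat_adjoint Z * X)"
    using Z X by (subst mult_smult_distrib[of _ 1 n _ 1]) (auto intro!: tr_smult[of _ 1])
  also have "mat_adjoint Z * X = mat_adjoint X * (B * X)"
    using B' X by (simp add: Z_def mat_adjoint_mult mat_mult_assoc)
  also have "tr \<dots> = complex_of_real (mip X (B * X))"
    by (rule tr_quadratic_real[OF B'(1,2) X(1)])
  finally have "\<mu> = complex_of_real (mip Z (S * Z) / mip X (B * X))"
    using b by (simp add: field_simps)
  then show ?thesis using s b by (intro exI[of _ "mip Z (S * Z) / mip X (B * X)"]) auto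
qed

lemma tr_similar:
  assumes "similar_mat A B"
  shows "tr A = tr B"
proof -
  obtain n P Q where c: "{A, B, P, Q} \<subseteq> carrier_mat n n" and QP: "Q * P = 1\<^sub>m n" and A: "A = P * B * Q"
    using similar_matD[OF assms] by blast
  have "tr A = tr (Q * (P * B))" unfolding A by (rule tr_mult_commute) (use c in auto)
  also have "Q * (P * B) = B" using c QP by (subst mat_mult_assoc[symmetric]) auto
  finally show ?thesis .
qed

text \<open>Schur triangularization also covers a product that is not normal. The diagonal of the
  triangular factor lists the eigenvalues, and determinant and trace are invariant under
  similarity.\<close>

lemma posdef_mult_spectrum:
  assumes S: "posdef n S" and B: "posdef n B"
  shows "\<exists>r. (\<forall>i<n. 0 < r i) \<and> det (S * B) = complex_of_real (\<Prod>i<n. r i) \<and>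
    tr (S * B) = complex_of_real (\<Sum>i<n. r i)"
proof -
  have SB: "S * B \<in> carrier_mat n n" using posdefD(1)[OF S] posdefD(1)[OF B] by auto
  obtain es where es: "char_poly (S * B) = (\<Prod>a\<leftarrow>es. [:- a, 1:])" "length es = n"
    using char_poly_factorized[OF SB] by blast
  obtain T P Q where T: "schur_decomposition (S * B) es = (T, P, Q)" by (metis prod_cases3)
  have T': "similar_mat_wit (S * B) T P Q" "upper_triangular T" "diag_mat T = es"
    using schur_decomposition[OF SB es(1) T] by auto
  have sim: "similar_mat (S * B) T" using T'(1) by (auto simp: similar_mat_def)
  have Tc: "T \<in> carrier_mat n n" using similar_mat_witD2[OF SB T'(1)] by auto
  have "\<exists>r>0. T $$ (i, i) = complex_of_real r" if "i < n" for i
  proof -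
    have "T $$ (i, i) = es ! i" using T'(3) Tc that by (auto simp: diag_mat_def)
    then have "T $$ (i, i) \<in> set es" using that es(2) by simp
    then have "poly (char_poly (S * B)) (T $$ (i, i)) = 0"
      unfolding es(1) by (auto simp: poly_prod_list prod_list_zero_iff)
    then have "eigenvalue (S * B) (T $$ (i, i))" using eigenvalue_root_char_poly[OF SB] by simp
    then show ?thesis by (rule posdef_mult_eigenvalue[OF S B])
  qed
  then obtain r where r: "\<And>i. i < n \<Longrightarrow> 0 < r i \<and> T $$ (i, i) = complex_of_real (r i)" by metis
  have "det (S * B) = (\<Prod>i<n. T $$ (i, i))"
    using det_similar[OF sim] det_upper_triangular[OF T'(2) Tc] Tc
    by (simp add: prod_list_diag_prod atLeast0LessThan)
  also have "\<dots> = complex_of_real (\<Prod>i<n. r i)" using r by (simp add: of_real_prod)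
  finally have "det (S * B) = complex_of_real (\<Prod>i<n. r i)" .
  moreover have "tr (S * B) = complex_of_real (\<Sum>i<n. r i)"
    using tr_similar[OF sim] Tc r by (simp add: tr_def of_real_sum)
  ultimately show ?thesis using r by blast
qed

lemma posdef_det:
  assumes "posdef n S"
  shows "det S = complex_of_real (Re (det S))" "0 < Re (det S)"
proof -
  obtain r where "\<forall>i<n. 0 < r i" "det (S * 1\<^sub>m n) = complex_of_real (\<Prod>i<n. r i)"
    using posdef_mult_spectrum[OF assms posdef_one] by blast
  then have "det S = complex_of_real (\<Prod>i<n. r i)" "0 < (\<Prod>i<n. r i)"
    using posdefD(1)[OF assms] by (auto intro!: prod_pos)
  then show "det S = complex_of_real (Re (det S))" "0 < Re (det S)" by (simp_all del: of_real_prod)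
qed

text \<open>Sums \<open>ln x \<le> x - 1\<close> over the spectrum of \<open>S * B\<close>. Both
  determinants are positive reals, so their real parts multiply and the logarithms add.\<close>

lemma logdet_add_le:
  assumes S: "posdef n S" and B: "posdef n B"
  shows "logdet S + logdet B \<le> Re (tr (S * B)) - n"
proof -
  obtain r where r: "\<forall>i<n. 0 < r i" "det (S * B) = complex_of_real (\<Prod>i<n. r i)"
    "tr (S * B) = complex_of_real (\<Sum>i<n. r i)"
    using posdef_mult_spectrum[OF S B] by blast
  have "complex_of_real (Re (det S) * Re (det B)) = det S * det B"
    using posdef_det(1)[OF S] posdef_det(1)[OF B] by simp
  also have "\<dots> = complex_of_real (\<Prod>i<n. r i)"
    using r(2) det_mult[OF posdefD(1)[OF S] posdefD(1)[OF B]] by simp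
  finally have "Re (det S) * Re (det B) = (\<Prod>i<n. r i)" by (simp only: of_real_eq_iff)
  then have "logdet S + logdet B = ln (\<Prod>i<n. r i)"
    unfolding logdet_def using posdef_det(2)[OF S] posdef_det(2)[OF B] by (simp add: ln_mult_pos[symmetric])
  also have "\<dots> = (\<Sum>i<n. ln (r i))" using r(1) by (intro ln_prod) auto
  also have "\<dots> \<le> (\<Sum>i<n. r i - 1)" using r(1) by (intro sum_mono ln_le_minus_one) auto
  also have "\<dots> = Re (tr (S * B)) - n" by (simp add: r(3) sum_subtractf)
  finally show ?thesis .
qed

lemma logdet_inverse:
  assumes S: "posdef n S" and B: "posdef n B" and "S * B = 1\<^sub>m n"
  shows "logdet B = - logdet S"
proof -
  have "det S * det B = 1" using det_mult[OF posdefD(1)[OF S] posdefD(1)[OF B]] assms(3) by simp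
  then have "complex_of_real (Re (det S) * Re (det B)) = complex_of_real 1"
    using posdef_det(1)[OF S] posdef_det(1)[OF B] by simp
  then have "Re (det S) * Re (det B) = 1" by (simp only: of_real_eq_iff)
  then have "ln (Re (det S)) + ln (Re (det B)) = 0"
    using posdef_det(2)[OF S] posdef_det(2)[OF B] by (simp add: ln_mult_pos[symmetric])
  then show ?thesis by (simp add: logdet_def)
qed

section \<open>The quadratic and Lagrangian dual transforms for one slot\<close>

lemma posdef_nonneg:
  assumes "posdef n A" "X \<in> carrier_mat n m"
  shows "0 \<le> mip X (A * X)"
proof (cases "X = 0\<^sub>m n m")
  case True
  then show ?thesis using posdefD(1)[OF assms(1)] mip_zero_right[of "0\<^sub>m n m" n m] by simp
next
  case False
  then show ?thesis using posdefD(3)[OF assms] by simp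
qed

text \<open>Taking adjoints turns right multiplication by \<open>S\<close> into the quadratic form
  of \<open>S\<close> at the adjoint of \<open>E\<close>.\<close>

lemma posdef_mip_mult_right:
  assumes S: "posdef d S" and E: "E \<in> carrier_mat m d"
  shows "0 \<le> mip E (E * S)"
proof -
  note S' = posdefD[OF S]
  have "mip E (E * S) = mip (mat_adjoint E) (mat_adjoint (E * S))"
    by (rule mip_adjoint[symmetric, of _ m d]) (use E S' in auto)
  also have "\<dots> = mip (mat_adjoint E) (S * mat_adjoint E)"
    using E S' by (simp add: mat_adjoint_mult)
  also have "0 \<le> \<dots>" by (rule posdef_nonneg[OF S]) (use E in auto)
  finally show ?thesis .
qed

text \<open>The last hypothesis says that \<open>Y\<close> solves the linear system of the total
  covariance \<open>T T^H + M\<close>. With \<open>K = T^H Y\<close> it reads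
  \<open>T (1 - K) = M Y\<close>; multiplying by \<open>T^H N\<close> gives
  \<open>G (1 - K) = K\<close>, which rearranges to the claim.\<close>

lemma woodbury:
  fixes T M N Y :: "complex mat"
  assumes T: "T \<in> carrier_mat r d" and M: "M \<in> carrier_mat r r" and N: "N \<in> carrier_mat r r"
    and NM: "N * M = 1\<^sub>m r" and Y: "Y \<in> carrier_mat r d"
    and eq: "T * mat_adjoint T * Y + M * Y = T"
  shows "(1\<^sub>m d + mat_adjoint T * (N * T)) * (1\<^sub>m d - mat_adjoint T * Y) = 1\<^sub>m d"
proof -
  define K where "K = mat_adjoint T * Y"
  define G where "G = mat_adjoint T * (N * T)"
  have K: "K \<in> carrier_mat d d" using T Y by (simp add: K_def mult_carrier_mat[of _ d r])
  have G: "G \<in> carrier_mat d d" using T N by (simp add: G_def mult_carrier_mat[of _ d r] mult_carrier_mat[of _ r r])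
  have c: "1\<^sub>m d - K \<in> carrier_mat d d" by (rule minus_carrier_mat[OF K])
  have P: "T * K \<in> carrier_mat r d" "M * Y \<in> carrier_mat r d"
    by (rule mult_carrier_mat[OF T K], rule mult_carrier_mat[OF M Y])
  have "T * mat_adjoint T * Y = T * K" unfolding K_def
    by (rule mat_mult_assoc) (use T Y in auto)
  then have TK: "T * K + M * Y = T" using eq by simp
  have cancel: "(P + Q) - P = Q" if "P \<in> carrier_mat r d" "Q \<in> carrier_mat r d" for P Q :: "complex mat"
    using that by (intro eq_matI) auto
  have "T * (1\<^sub>m d - K) = T - T * K"
    unfolding mult_minus_distrib_mat[OF T one_carrier_mat K] right_mult_one_mat[OF T] ..
  also have "\<dots> = (T * K + M * Y) - T * K" by (simp only: TK)
  also have "\<dots> = M * Y" by (rule cancel[OF P])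
  finally have e: "T * (1\<^sub>m d - K) = M * Y" .
  have "G * (1\<^sub>m d - K) = mat_adjoint T * (N * (T * (1\<^sub>m d - K)))"
    unfolding G_def using T N K by (simp add: mat_mult_assoc)
  also have "\<dots> = mat_adjoint T * (N * M * Y)"
    unfolding e using M N Y by (simp add: mat_mult_assoc)
  also have "\<dots> = K" using Y by (simp add: NM K_def)
  finally have f: "G * (1\<^sub>m d - K) = K" .
  have "(1\<^sub>m d + G) * (1\<^sub>m d - K) = (1\<^sub>m d - K) + K"
    unfolding add_mult_distrib_mat[OF one_carrier_mat G c] f left_mult_one_mat[OF c] ..
  also have "\<dots> = 1\<^sub>m d" using K by (intro eq_matI) auto
  finally show ?thesis unfolding G_def K_def .
qed

text \<open>One slot seen from its receiver: \<open>T\<close> is the effective channel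
  \<open>H V\<close>, \<open>M\<close> the covariance of interference and noise, \<open>J\<close>
  the total covariance. Below, \<open>G\<close> is the update of Gamma, \<open>Y0\<close> the
  minimum mean square error receiver and \<open>1 - K\<close> its error matrix. Coercivity with the
  constant \<open>s\<close> records the noise floor.\<close>

locale slot_covariance =
  fixes r d :: nat and s :: real and T M J :: "complex mat"
  assumes T: "T \<in> carrier_mat r d" and M: "M \<in> carrier_mat r r"
    and M_herm: "mat_adjoint M = M" and s: "0 < s"
    and M_coercive: "\<And>m X. X \<in> carrier_mat r m \<Longrightarrow> s * mip X X \<le> mip X (M * X)"
    and J_eq: "J = T * mat_adjoint T + M"
begin

definition "G = mat_adjoint T * (minv M * T)"
definition "Y0 = minv J * T"
definition "K = mat_adjoint T * Y0"
abbreviation "A \<equiv> 1\<^sub>m d + G"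

lemma M_posdef: "posdef r M"
proof (rule posdefI[OF M M_herm])
  fix m and X :: "complex mat" assume X: "X \<in> carrier_mat r m" "X \<noteq> 0\<^sub>m r m"
  have "0 < s * mip X X" using s mip_self_pos[OF X] by simp
  then show "0 < mip X (M * X)" using M_coercive[OF X(1)] by simp
qed

lemma J: "J \<in> carrier_mat r r"
  using T M by (auto simp: J_eq)

lemma J_posdef: "posdef r J"
proof (rule posdefI[OF J])
  show "mat_adjoint J = J" unfolding J_eq
    using T M M_herm by (simp add: mat_adjoint_add[of _ r r] mat_adjoint_mult)
  fix m and X :: "complex mat" assume X: "X \<in> carrier_mat r m" "X \<noteq> 0\<^sub>m r m"
  have TX: "mat_adjoint T * X \<in> carrier_mat d m" using T X by auto
  have MX: "M * X \<in> carrier_mat r m" using M X by auto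
  have TTX: "T * (mat_adjoint T * X) \<in> carrier_mat r m" using T TX by auto
  have "J * X = T * (mat_adjoint T * X) + M * X"
    unfolding J_eq using T M X by (subst add_mult_distrib_mat[of _ r r _ _ m]) (auto simp: mat_mult_assoc)
  then have "mip X (J * X) = mip X (T * (mat_adjoint T * X)) + mip X (M * X)"
    using mip_add_right[OF X(1) TTX MX] by simp
  also have "mip X (T * (mat_adjoint T * X)) = mip (mat_adjoint T * X) (mat_adjoint T * X)"
    using mip_mult_left[of "mat_adjoint T" d r X m "mat_adjoint T * X"] T X TX by simp
  finally show "0 < mip X (J * X)"
    using posdefD(3)[OF M_posdef X] mip_self_nonneg[of "mat_adjoint T * X"] by simp
qed

lemmas minv_M = minv[OF M posdef_det_nonzero[OF M_posdef]]
lemmas minv_J = minv[OF J posdef_det_nonzero[OF J_posdef]]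

lemma minv_M_posdef: "posdef r (minv M)"
  by (rule posdef_inverse[OF M_posdef minv_M(3,1)])

lemma Y0: "Y0 \<in> carrier_mat r d"
  using minv_J T by (auto simp: Y0_def)

lemma J_Y0: "J * Y0 = T"
  unfolding Y0_def using minv_J J T by (subst mat_mult_assoc[symmetric]) auto

lemma K: "K \<in> carrier_mat d d"
  using Y0 T by (auto simp: K_def)

lemma K_eq: "mat_adjoint Y0 * T = K"
  using minv_J T minv_hermitian[OF J posdef_det_nonzero[OF J_posdef] posdefD(2)[OF J_posdef]]
  by (simp add: K_def Y0_def mat_adjoint_mult mat_mult_assoc)

lemma G: "G \<in> carrier_mat d d"
  using minv_M T by (auto simp: G_def)

lemma G_nonneg:
  assumes X: "X \<in> carrier_mat d m"
  shows "0 \<le> mip X (G * X)"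
proof -
  have "mip X (G * X) = mip X (mat_adjoint T * (minv M * (T * X)))"
    using T X minv_M by (simp add: G_def mat_mult_assoc)
  also have "\<dots> = mip (T * X) (minv M * (T * X))"
    by (rule mip_mult_left[symmetric, OF T X]) (use minv_M T X in auto)
  also have "0 \<le> \<dots>" by (rule posdef_nonneg[OF minv_M_posdef]) (use T X in auto)
  finally show ?thesis .
qed

lemma A_posdef: "posdef d A"
proof (rule posdefI)
  show "A \<in> carrier_mat d d" using G by auto
  show "mat_adjoint A = A"
    using G T minv_M posdefD(2)[OF minv_M_posdef]
    by (simp add: mat_adjoint_add[of _ d d]) (simp add: G_def mat_adjoint_mult mat_mult_assoc)
  fix m and X :: "complex mat" assume X: "X \<in> carrier_mat d m" "X \<noteq> 0\<^sub>m d m"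
  have "A * X = X + G * X"
    using G X by (simp add: add_mult_distrib_mat[of _ d d _ _ m])
  moreover have "G * X \<in> carrier_mat d m" using G X by auto
  ultimately have "mip X (A * X) = mip X X + mip X (G * X)"
    using mip_add_right[OF X(1) X(1)] by simp
  then show "0 < mip X (A * X)" using mip_self_pos[OF X] G_nonneg[OF X(1)] by simp
qed

lemma A_inverse: "A * (1\<^sub>m d - K) = 1\<^sub>m d"
unfolding G_def K_def
proof (rule woodbury[OF T M minv_M(3,2) Y0])
  have "J * Y0 = (T * mat_adjoint T + M) * Y0"
    by (rule arg_cong[OF J_eq, of "\<lambda>B. B * Y0"])
  also have "\<dots> = T * mat_adjoint T * Y0 + M * Y0"
    by (rule add_mult_distrib_mat[of _ r r _ _ d]) (use T M Y0 in auto)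
  finally show "T * mat_adjoint T * Y0 + M * Y0 = T" unfolding J_Y0 ..
qed

lemma tr_mult_A_inverse:
  assumes "S \<in> carrier_mat d d"
  shows "tr (S * (1\<^sub>m d - K)) = tr S - tr (S * K)"
proof -
  have "S * (1\<^sub>m d - K) = S - S * K"
    unfolding mult_minus_distrib_mat[OF assms one_carrier_mat K] right_mult_one_mat[OF assms] ..
  then show ?thesis using assms K by (simp add: tr_diff[of _ d])
qed

text \<open>At \<open>S\<close>, the left side is the value of the completed square at its maximizer
  \<open>Y0\<close>; the right side puts it in the form that meets the trace inequality.\<close>

lemma mip_Y0:
  assumes "S \<in> carrier_mat d d"
  shows "mip Y0 (T * S) = Re (tr (S * K))"
proof -
  have "mip Y0 (T * S) = Re (tr (K * S))"
    unfolding mip_def K_eq[symmetric] using assms T Y0 by (simp add: mat_mult_assoc)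
  then show ?thesis using tr_mult_commute[OF K assms] by simp
qed

lemma mip_T:
  assumes "S \<in> carrier_mat d d" "mat_adjoint S = S" "Y \<in> carrier_mat r d"
  shows "mip Y (T * S) = mip T (Y * S)"
  using mip_mult_right[OF assms(3) T assms(1)] assms mip_commute[of "Y * S" r d T] T by simp

text \<open>Completing the square in \<open>Y\<close> leaves the maximum over \<open>Y\<close>, attained at \<open>Y0\<close>; since
  \<open>I - K\<close> is the inverse of \<open>A\<close>, the rest is \<open>ln x \<le> x - 1\<close> for the eigenvalues of
  \<open>S (I - K)\<close>.\<close>

lemma transform_le:
  assumes S: "posdef d S" and Y: "Y \<in> carrier_mat r d"
    and J_pos: "\<And>D. D \<in> carrier_mat r d \<Longrightarrow> 0 \<le> mip D (J * (D * S))"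
  shows "logdet S - (Re (tr S) - d) + 2 * mip T (Y * S) - mip Y (J * (Y * S)) \<le> logdet A"
proof -
  note S' = posdefD(1,2)[OF S]
  \<comment> \<open>\<open>J * Y0 = T\<close> makes \<open>Y0\<close> the centre of the square;
    \<open>D\<close> is the deviation from it.\<close>
  define D where "D = Y - Y0"
  have D: "D \<in> carrier_mat r d" using Y Y0 by (auto simp: D_def)
  have YS: "Y * S \<in> carrier_mat r d" and Y0S: "Y0 * S \<in> carrier_mat r d"
    and TS: "T * S \<in> carrier_mat r d" using Y Y0 T S' by auto
  have JYS: "J * (Y * S) \<in> carrier_mat r d" using J YS by auto
  have "J * (Y0 * S) = J * Y0 * S"
    by (rule mat_mult_assoc[symmetric]) (use J Y0 S' in auto)
  also have "\<dots> = T * S" unfolding J_Y0 ..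
  finally have JY0S: "J * (Y0 * S) = T * S" .
  have "J * (D * S) = J * (Y * S) - T * S"
    unfolding D_def minus_mult_distrib_mat[OF Y Y0 S'(1)] mult_minus_distrib_mat[OF J YS Y0S] JY0S ..
  then have "mip D (J * (D * S)) =
      mip Y (J * (Y * S)) - mip Y (T * S) - (mip Y0 (J * (Y * S)) - mip Y0 (T * S))"
    unfolding D_def using Y Y0 JYS TS
    by (simp add: mip_diff_left[of _ r d] mip_diff_right[of _ r d])
  also have "mip Y (T * S) = mip T (Y * S)" by (rule mip_T[OF S' Y])
  also have "mip Y0 (J * (Y * S)) = mip T (Y * S)"
    using mip_mult_left[OF J Y0 YS] posdefD(2)[OF J_posdef] J_Y0 by simp
  finally have 1: "2 * mip T (Y * S) - mip Y (J * (Y * S)) \<le> mip Y0 (T * S)"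
    using J_pos[OF D] by simp
  have B: "posdef d (1\<^sub>m d - K)"
    by (rule posdef_inverse[OF A_posdef _ A_inverse]) (use K in auto)
  have "logdet S + logdet (1\<^sub>m d - K) \<le> Re (tr (S * (1\<^sub>m d - K))) - d"
    by (rule logdet_add_le[OF S B])
  moreover have "logdet (1\<^sub>m d - K) = - logdet A"
    by (rule logdet_inverse[OF A_posdef B A_inverse])
  ultimately show ?thesis
    using 1 mip_Y0[OF S'(1)] tr_mult_A_inverse[OF S'(1)] by simp
qed

text \<open>The two quadratic terms leave \<open>Re (tr (A * K))\<close>, and
  \<open>A * (1 - K) = 1\<close> makes this \<open>Re (tr A) - d\<close>, which cancels the trace
  penalty.\<close>

lemma transform_eq:
  "logdet A - (Re (tr A) - d) + 2 * mip T (Y0 * A) - mip Y0 (J * (Y0 * A)) = logdet A"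
proof -
  note A' = posdefD(1,2)[OF A_posdef]
  have "J * (Y0 * A) = J * Y0 * A"
    by (rule mat_mult_assoc[symmetric]) (use J Y0 G in auto)
  also have "\<dots> = T * A" unfolding J_Y0 ..
  finally have "J * (Y0 * A) = T * A" .
  moreover have "Re (tr (A * K)) = Re (tr A) - d"
    using arg_cong[OF tr_mult_A_inverse[OF A'(1)], of Re] unfolding A_inverse by (simp add: tr_one)
  ultimately show ?thesis using mip_T[OF A' Y0] mip_Y0[OF A'(1)] by simp
qed

text \<open>Comparison with the identity gives \<open>logdet A \<le> Re (tr G)\<close>, which is
  \<open>mip T X\<close> for the solution of \<open>M * X = T\<close>. Coercivity gives
  \<open>s * mip X X \<le> mip T X\<close>, and Cauchy-Schwarz eliminates \<open>X\<close>. This is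
  what bounds the rate on the feasible set.\<close>

lemma logdet_A_le: "logdet A \<le> mip T T / s"
proof -
  define X where "X = minv M * T"
  have X: "X \<in> carrier_mat r d" using minv_M T by (auto simp: X_def)
  have MX: "M * X = T" unfolding X_def using minv_M M T by (subst mat_mult_assoc[symmetric]) auto
  have "logdet A + logdet (1\<^sub>m d) \<le> Re (tr (A * 1\<^sub>m d)) - d"
    by (rule logdet_add_le[OF A_posdef posdef_one])
  moreover have "logdet (1\<^sub>m d) = 0" by (simp add: logdet_def)
  moreover have "Re (tr (A * 1\<^sub>m d)) = d + mip T X"
    using posdefD(1)[OF A_posdef] G by (simp add: tr_add[of _ d] tr_one) (simp add: mip_def X_def G_def)
  ultimately have 1: "logdet A \<le> mip T X" by simp
  have 2: "s * mip X X \<le> mip T X" using M_coercive[OF X] MX mip_commute[OF T X] by simp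
  have "s * (mip T X * mip T X) \<le> s * (mip T T * mip X X)"
    using mip_Cauchy_Schwarz[OF T X] s by (simp add: power2_eq_square)
  also have "\<dots> \<le> mip T T * mip T X"
    using mult_left_mono[OF 2 mip_self_nonneg[of T]] by (simp add: algebra_simps)
  finally have "s * (mip T X * mip T X) \<le> mip T T * mip T X" .
  then have "mip T X * (s * mip T X) \<le> mip T X * mip T T" by (simp add: algebra_simps)
  moreover have "0 \<le> mip T T" by (rule mip_self_nonneg)
  \<comment> \<open>Cancelling \<open>mip T X\<close> requires it to be positive; otherwise the
    bound holds by sign.\<close>
  moreover have "s * mip T X \<le> 0" if "\<not> 0 < mip T X"
    using that s by (simp add: mult_nonneg_nonpos)
  ultimately have "s * mip T X \<le> mip T T"
    by (cases "0 < mip T X") auto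
  then have "mip T X \<le> mip T T / s" using s by (simp add: pos_le_divide_eq mult.commute)
  then show ?thesis using 1 by linarith
qed

end

section \<open>The network surrogate\<close>

locale rbg_network =
  fixes net :: network and k :: allocation
  assumes net: "valid_network net" and alloc: "rbg_allocation net k"
begin

abbreviation "Act \<equiv> active net k"
abbreviation "rx \<equiv> rx_antennas net"
abbreviation "tx \<equiv> tx_antennas net"
abbreviation "d p \<equiv> streams net (fst p)"
abbreviation "\<rho> p \<equiv> weight net (fst p)"
abbreviation "noise \<equiv> noise_power net"
abbreviation "co p \<equiv> cochannel net k p"
abbreviation "S W p \<equiv> 1\<^sub>m (d p) + Gamma_upd net k W p"
abbreviation "Y W p \<equiv> Y_upd net k W p"

lemma finite_Act: "finite Act"
  by (rule finite_subset[of _ "{..<user_count net} \<times> {..<slot_count net}"]) (auto simp: active_def)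

lemma finite_co: "finite (co p)"
  using finite_Act by (auto simp: cochannel_def)

lemma co_Act: "q \<in> co p \<Longrightarrow> q \<in> Act"
  by (simp add: cochannel_def)

lemma co_self: "p \<in> Act \<Longrightarrow> p \<in> co p"
  by (simp add: cochannel_def)

lemma noise_pos: "0 < noise" and weight_nonneg: "p \<in> Act \<Longrightarrow> 0 \<le> \<rho> p"
  using net by (auto simp: valid_network_def active_def)

lemma chan_carrier:
  assumes "p \<in> Act" "q \<in> Act"
  shows "chan_from net k q p \<in> carrier_mat rx tx"
  using net alloc assms
  by (auto simp: chan_from_def valid_network_def active_def rbg_allocation_def)

lemma beam_carrier: "V \<in> beam_space net k \<Longrightarrow> p \<in> Act \<Longrightarrow> V p \<in> carrier_mat tx (d p)"
  by (auto simp: beam_space_def)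

section \<open>Received covariances\<close>

context
  fixes V p q
  assumes V: "V \<in> beam_space net k" and p: "p \<in> Act" and q: "q \<in> Act"
begin

lemma rx_cov_eq:
  "rx_cov net k V p q = (chan_from net k q p * V q) * mat_adjoint (chan_from net k q p * V q)"
  using chan_carrier[OF p q] beam_carrier[OF V q]
  by (simp add: rx_cov_def mat_adjoint_mult mat_mult_assoc)

lemma rx_signal_carrier: "chan_from net k q p * V q \<in> carrier_mat rx (d q)"
  using chan_carrier[OF p q] beam_carrier[OF V q] by auto

lemma rx_cov_carrier: "rx_cov net k V p q \<in> carrier_mat rx rx"
  unfolding rx_cov_eq using rx_signal_carrier by auto

lemma rx_cov_hermitian: "mat_adjoint (rx_cov net k V p q) = rx_cov net k V p q"
  unfolding rx_cov_eq using rx_signal_carrier by (simp add: mat_adjoint_mult)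

lemma mip_rx_cov:
  assumes "D \<in> carrier_mat rx m" "Z \<in> carrier_mat rx m"
  shows "mip D (rx_cov net k V p q * Z) =
    mip (mat_adjoint (chan_from net k q p * V q) * D) (mat_adjoint (chan_from net k q p * V q) * Z)"
proof -
  let ?G = "chan_from net k q p * V q"
  note G = rx_signal_carrier
  have "rx_cov net k V p q * Z = ?G * (mat_adjoint ?G * Z)"
    unfolding rx_cov_eq by (rule mat_mult_assoc) (use G assms in auto)
  then show ?thesis
    using mip_mult_left[of "mat_adjoint ?G" "d q" rx D m "mat_adjoint ?G * Z"] assms G
    by (simp add: mult_carrier_mat[of _ "d q" rx])
qed

end

context
  fixes V p
  assumes V: "V \<in> beam_space net k" and p: "p \<in> Act"
begin

lemma M_carrier: "M_mat net k V p \<in> carrier_mat rx rx"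
  by (simp add: M_mat_def)

lemma M_hermitian: "mat_adjoint (M_mat net k V p) = M_mat net k V p"
proof -
  have "mat_adjoint (msum rx rx (rx_cov net k V p) (co p - {p})) = msum rx rx (rx_cov net k V p) (co p - {p})"
    by (rule msum_hermitian)
      (auto intro!: rx_cov_carrier[OF V p] rx_cov_hermitian[OF V p] intro: co_Act)
  then show ?thesis
    by (simp add: M_mat_def mat_adjoint_add[of _ rx rx] mat_adjoint_smult)
qed

lemma mip_M:
  assumes "D \<in> carrier_mat rx m" "Z \<in> carrier_mat rx m"
  shows "mip D (M_mat net k V p * Z) =
    (\<Sum>q\<in>co p - {p}. mip D (rx_cov net k V p q * Z)) + noise * mip D Z"
proof -
  have "M_mat net k V p * Z =
      msum rx rx (rx_cov net k V p) (co p - {p}) * Z + complex_of_real noise \<cdot>\<^sub>m Z"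
    unfolding M_mat_def using assms
    by (subst add_mult_distrib_mat[of _ rx rx _ _ m]) (auto simp: mult_smult_assoc_mat[of _ rx rx _ m])
  moreover have "msum rx rx (rx_cov net k V p) (co p - {p}) * Z \<in> carrier_mat rx m"
    using assms(2) by (intro mult_carrier_mat[of _ rx rx]) auto
  moreover have "mip D (msum rx rx (rx_cov net k V p) (co p - {p}) * Z) =
      (\<Sum>q\<in>co p - {p}. mip D (rx_cov net k V p q * Z))"
    by (rule mip_msum[of _ _ _ _ _ m])
      (use finite_co assms in \<open>auto intro!: rx_cov_carrier[OF V p] intro: co_Act\<close>)
  ultimately show ?thesis using assms
    by (simp add: mip_add_right[of _ rx m] mip_smult_right[of _ rx m])
qed

lemma mip_J:
  assumes "D \<in> carrier_mat rx m" "Z \<in> carrier_mat rx m"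
  shows "mip D (J_mat net k V p * Z) =
    (\<Sum>q\<in>co p. mip D (rx_cov net k V p q * Z)) + noise * mip D Z"
proof -
  note c = rx_cov_carrier[OF V p p] M_carrier
  have "J_mat net k V p * Z = rx_cov net k V p p * Z + M_mat net k V p * Z"
    unfolding J_mat_def by (rule add_mult_distrib_mat[OF c assms(2)])
  moreover have "rx_cov net k V p p * Z \<in> carrier_mat rx m" "M_mat net k V p * Z \<in> carrier_mat rx m"
    using c assms by auto
  ultimately have "mip D (J_mat net k V p * Z) =
      mip D (rx_cov net k V p p * Z) + mip D (M_mat net k V p * Z)"
    using assms by (simp add: mip_add_right[of _ rx m])
  then show ?thesis
    using mip_M[OF assms] sum.remove[OF finite_co co_self[OF p], of "\<lambda>q. mip D (rx_cov net k V p q * Z)"]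
    by simp
qed

lemma M_coercive:
  assumes X: "X \<in> carrier_mat rx m"
  shows "noise * mip X X \<le> mip X (M_mat net k V p * X)"
proof -
  have "0 \<le> (\<Sum>q\<in>co p - {p}. mip X (rx_cov net k V p q * X))"
    by (intro sum_nonneg) (metis DiffD1 co_Act mip_rx_cov[OF V p _ X X] mip_self_nonneg)
  then show ?thesis using mip_M[OF X X] by simp
qed

text \<open>The trace of a product with two positive factors is handled without matrix square roots:
  splitting \<open>J_mat\<close> into covariances \<open>F F^H\<close> and noise turns each term
  into \<open>mip E (E * R)\<close> with \<open>E = F^H D\<close>, or with \<open>E = D\<close> for
  the noise.\<close>

lemma J_mip_nonneg:
  assumes S: "posdef n R" and D: "D \<in> carrier_mat rx n"
  shows "0 \<le> mip D (J_mat net k V p * (D * R))"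
proof -
  have DR: "D * R \<in> carrier_mat rx n" using D posdefD(1)[OF S] by auto
  have "0 \<le> mip D (rx_cov net k V p q * (D * R))" if "q \<in> co p" for q
  proof -
    have q: "q \<in> Act" by (rule co_Act[OF that])
    let ?G = "mat_adjoint (chan_from net k q p * V q)"
    have G: "?G \<in> carrier_mat (d q) rx" using rx_signal_carrier[OF V p q] by simp
    have GD: "?G * D \<in> carrier_mat (d q) n" using G D by auto
    have "?G * (D * R) = ?G * D * R"
      by (rule mat_mult_assoc[symmetric]) (use G D posdefD(1)[OF S] in auto)
    then show ?thesis
      unfolding mip_rx_cov[OF V p q D DR] using posdef_mip_mult_right[OF S GD] by simp
  qed
  then show ?thesis
    unfolding mip_J[OF D DR] using posdef_mip_mult_right[OF S D] noise_pos
    by (auto intro!: add_nonneg_nonneg sum_nonneg)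
qed

lemma slot: "slot_covariance rx (d p) noise (direct_chan net k p * V p) (M_mat net k V p) (J_mat net k V p)"
  by unfold_locales
    (use rx_signal_carrier[OF V p p] M_carrier M_hermitian noise_pos M_coercive rx_cov_eq[OF V p p]
      in \<open>auto simp: J_mat_def\<close>)

end

section \<open>The transforms at the auxiliary updates\<close>

context
  fixes W p
  assumes W: "W \<in> beam_space net k" and p: "p \<in> Act"
begin

interpretation slot_covariance rx "d p" noise "direct_chan net k p * W p"
  "M_mat net k W p" "J_mat net k W p"
  by (rule slot[OF W p])

lemma Gamma_upd_eq: "Gamma_upd net k W p = G"
  unfolding Gamma_upd_def G_def
  using chan_carrier[OF p p] beam_carrier[OF W p] minv_M
  by (simp add: mat_adjoint_mult mat_mult_assoc)

lemma Y_upd_eq: "Y W p = Y0"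
  unfolding Y_upd_def Y0_def
  using chan_carrier[OF p p] beam_carrier[OF W p] minv_J by (simp add: mat_mult_assoc)

lemma S_posdef: "posdef (d p) (S W p)"
  unfolding Gamma_upd_eq by (rule A_posdef)

lemma Y_carrier: "Y W p \<in> carrier_mat rx (d p)"
  unfolding Y_upd_eq by (rule Y0)

lemma tr_Gamma_upd: "Re (tr (Gamma_upd net k W p)) = Re (tr (S W p)) - d p"
  unfolding Gamma_upd_eq using G by (simp add: tr_add[of _ "d p"] tr_one)

lemma rate_eq:
  "logdet (S W p) - (Re (tr (S W p)) - d p)
     + 2 * mip (direct_chan net k p * W p) (Y W p * S W p)
     - mip (Y W p) (J_mat net k W p * (Y W p * S W p)) = logdet (S W p)"
  unfolding Gamma_upd_eq Y_upd_eq by (rule transform_eq)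

text \<open>\<open>R\<close> and \<open>Z\<close> are arbitrary, so that auxiliary variables
  computed at a different point can be inserted.\<close>

lemma rate_le:
  "posdef (d p) R \<Longrightarrow> Z \<in> carrier_mat rx (d p) \<Longrightarrow>
   logdet R - (Re (tr R) - d p) + 2 * mip (direct_chan net k p * W p) (Z * R)
     - mip Z (J_mat net k W p * (Z * R)) \<le> logdet (S W p)"
  unfolding Gamma_upd_eq by (rule transform_le) (auto intro: J_mip_nonneg[OF W p])

lemma logdet_S_le:
  "logdet (S W p) \<le> mip (direct_chan net k p * W p) (direct_chan net k p * W p) / noise"
  unfolding Gamma_upd_eq by (rule logdet_A_le)

end

section \<open>Linear and quadratic coefficients of the surrogate\<close>

lemma mip_Lambda:
  assumes W: "W \<in> beam_space net k" and p: "p \<in> Act" and X: "X \<in> carrier_mat tx (d p)"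
  shows "mip X (Lambda_at net k W p) = \<rho> p * mip (direct_chan net k p * X) (Y W p * S W p)"
proof -
  note c = chan_carrier[OF p p] Y_carrier[OF W p] posdefD(1)[OF S_posdef[OF W p]]
  have YS: "Y W p * S W p \<in> carrier_mat rx (d p)" by (rule mult_carrier_mat[OF c(2,3)])
  have HYS: "mat_adjoint (direct_chan net k p) * (Y W p * S W p) \<in> carrier_mat tx (d p)"
    using c(1) YS by (intro mult_carrier_mat[of _ tx rx]) auto
  have "mat_adjoint (direct_chan net k p) * Y W p * S W p = mat_adjoint (direct_chan net k p) * (Y W p * S W p)"
    by (rule mat_mult_assoc) (use c in auto)
  then show ?thesis
    using mip_mult_left[OF c(1) X YS] mip_smult_right[OF X HYS]
    by (simp add: Lambda_at_def Lambda_mat_def)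
qed

lemma Lambda_carrier:
  assumes W: "W \<in> beam_space net k" and p: "p \<in> Act"
  shows "Lambda_at net k W p \<in> carrier_mat tx (d p)"
proof -
  note c = chan_carrier[OF p p] Y_carrier[OF W p] posdefD(1)[OF S_posdef[OF W p]]
  have "mat_adjoint (direct_chan net k p) * Y W p \<in> carrier_mat tx (d p)"
    using c by (intro mult_carrier_mat[of _ tx rx]) auto
  then show ?thesis unfolding Lambda_at_def Lambda_mat_def
    using mult_carrier_mat[OF _ c(3)] by auto
qed

abbreviation "L_term W p q \<equiv> mat_adjoint (chan_from net k p q)
   * Psi_mat net (Gamma_upd net k W) (Y_upd net k W) q * chan_from net k p q"

context
  fixes W p q
  assumes W: "W \<in> beam_space net k" and p: "p \<in> Act" and q: "q \<in> Act"
begin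

lemma Psi_carrier: "Psi_mat net (Gamma_upd net k W) (Y_upd net k W) q \<in> carrier_mat rx rx"
  unfolding Psi_mat_def using Y_carrier[OF W q] posdefD(1)[OF S_posdef[OF W q]]
  by (intro mult_carrier_mat[of _ rx "d q"]) auto

lemma Psi_hermitian:
  "mat_adjoint (Psi_mat net (Gamma_upd net k W) (Y_upd net k W) q)
    = Psi_mat net (Gamma_upd net k W) (Y_upd net k W) q"
proof -
  define R where "R = S W q"
  have "R \<in> carrier_mat (d q) (d q)" "mat_adjoint R = R"
    using posdefD(1,2)[OF S_posdef[OF W q]] by (auto simp: R_def)
  then show ?thesis
    unfolding Psi_mat_def R_def[symmetric] using Y_carrier[OF W q]
    by (simp add: mat_adjoint_mult mat_mult_assoc)
qed

lemma L_term_carrier: "L_term W p q \<in> carrier_mat tx tx"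
  using Psi_carrier chan_carrier[OF q p]
  by (intro mult_carrier_mat[of _ tx rx]) auto

lemma L_term_hermitian: "mat_adjoint (L_term W p q) = L_term W p q"
  using Psi_carrier Psi_hermitian chan_carrier[OF q p]
  by (simp add: mat_adjoint_mult mat_mult_assoc)

text \<open>Duality of leakage and interference: if \<open>F\<close> is the signal of
  \<open>p\<close> at the receiver of \<open>q\<close> and \<open>E = F^H Y\<close>, both sides
  equal \<open>mip E (E * R)\<close>. The signal belongs to \<open>V\<close>, the receiver and the
  weight \<open>R\<close> to \<open>W\<close>.\<close>

lemma mip_L_term:
  assumes V: "V \<in> beam_space net k"
  shows "mip (V p) (L_term W p q * V p) = mip (Y W q) (rx_cov net k V q p * (Y W q * S W q))"
proof -
  define R where "R = S W q"
  define H where "H = chan_from net k p q"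
  define F where "F = H * V p"
  define E where "E = mat_adjoint F * Y W q"
  have R: "R \<in> carrier_mat (d q) (d q)" and hR: "mat_adjoint R = R"
    using posdefD(1,2)[OF S_posdef[OF W q]] by (simp_all add: R_def)
  have H: "H \<in> carrier_mat rx tx" using chan_carrier[OF q p] by (simp add: H_def)
  note Vp = beam_carrier[OF V p] and Yq = Y_carrier[OF W q]
  have F: "F \<in> carrier_mat rx (d p)" using H Vp by (auto simp: F_def)
  have E: "E \<in> carrier_mat (d p) (d q)" unfolding E_def using F Yq by (intro mult_carrier_mat[of _ _ rx]) auto
  have ER: "E * R \<in> carrier_mat (d p) (d q)" using E R by auto
  have YR: "Y W q * R \<in> carrier_mat rx (d q)" using Yq R by auto
  have aE: "mat_adjoint E = mat_adjoint (Y W q) * F" using F Yq by (simp add: E_def mat_adjoint_mult)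
  have REF: "R * mat_adjoint E \<in> carrier_mat (d q) (d p)" using R E by (intro mult_carrier_mat[of _ _ "d q"]) auto
  have YREF: "Y W q * (R * mat_adjoint E) \<in> carrier_mat rx (d p)"
    by (rule mult_carrier_mat[OF Yq REF])
  have "L_term W p q * V p = mat_adjoint H * (Y W q * (R * mat_adjoint E))"
    unfolding Psi_mat_def R_def[symmetric] H_def[symmetric] aE F_def
    using H Yq R Vp by (simp add: mat_mult_assoc)
  then have "mip (V p) (L_term W p q * V p) = mip F (Y W q * (R * mat_adjoint E))"
    using mip_mult_left[OF H Vp YREF] by (simp add: F_def)
  also have "\<dots> = mip (Y W q * (R * mat_adjoint E)) F"
    by (rule mip_commute[OF F YREF])
  also have "\<dots> = mip (R * mat_adjoint E) (mat_adjoint E)"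
    using mip_mult_left[OF Yq REF F] aE by simp
  also have "\<dots> = mip (mat_adjoint E) (R * mat_adjoint E)"
    by (rule mip_commute[of _ "d q" "d p"]) (use REF E in auto)
  also have "R * mat_adjoint E = mat_adjoint (E * R)"
    using E R hR by (simp add: mat_adjoint_mult)
  also have "mip (mat_adjoint E) \<dots> = mip E (E * R)" by (rule mip_adjoint[OF E ER])
  also have "E * R = mat_adjoint F * (Y W q * R)" unfolding E_def using F Yq R by (simp add: mat_mult_assoc)
  also have "mip E \<dots> = mip (Y W q) (rx_cov net k V q p * (Y W q * R))"
    unfolding mip_rx_cov[OF V q p Yq YR] E_def F_def H_def ..
  finally show ?thesis by (simp add: R_def)
qed

end

context
  fixes W p
  assumes W: "W \<in> beam_space net k" and p: "p \<in> Act"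
begin

lemma L_carrier: "L_at net k W p \<in> carrier_mat tx tx"
  by (simp add: L_at_def L_mat_def)

lemma L_hermitian: "mat_adjoint (L_at net k W p) = L_at net k W p"
  unfolding L_at_def L_mat_def
  by (rule msum_hermitian)
    (simp_all only: smult_carrier_mat L_term_carrier[OF W p co_Act] L_term_hermitian[OF W p co_Act]
      mat_adjoint_smult complex_cnj_complex_of_real)

lemma mip_L:
  assumes V: "V \<in> beam_space net k"
  shows "mip (V p) (L_at net k W p * V p) =
    (\<Sum>q\<in>co p. \<rho> q * mip (Y W q) (rx_cov net k V q p * (Y W q * S W q)))"
proof -
  note Vp = beam_carrier[OF V p]
  have "mip (V p) (L_at net k W p * V p) =
      (\<Sum>q\<in>co p. mip (V p) ((complex_of_real (\<rho> q) \<cdot>\<^sub>m L_term W p q) * V p))"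
    unfolding L_at_def L_mat_def
    by (rule mip_msum[OF finite_co _ Vp Vp])
       (simp only: smult_carrier_mat L_term_carrier[OF W p co_Act])
  also have "\<dots> = (\<Sum>q\<in>co p. \<rho> q * mip (Y W q) (rx_cov net k V q p * (Y W q * S W q)))"
  proof (rule sum.cong[OF refl])
    fix q assume "q \<in> co p"
    then have q: "q \<in> Act" by (rule co_Act)
    note c = L_term_carrier[OF W p q]
    show "mip (V p) ((complex_of_real (\<rho> q) \<cdot>\<^sub>m L_term W p q) * V p) =
        \<rho> q * mip (Y W q) (rx_cov net k V q p * (Y W q * S W q))"
      unfolding mult_smult_assoc_mat[OF c Vp] mip_smult_right[OF Vp mult_carrier_mat[OF c Vp]]
        mip_L_term[OF W p q V] ..
  qed
  finally show ?thesis .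
qed

end

text \<open>This is \<open>f_P4\<close> at \<open>Z = V\<close> with the auxiliary variables updated
  at \<open>W\<close>; for this \<open>Z\<close> the terms in \<open>lam\<close> cancel.\<close>

definition surr :: "mat_family \<Rightarrow> mat_family \<Rightarrow> real" where
  "surr W V = (\<Sum>p\<in>Act.
     \<rho> p * (logdet (S W p) - Re (tr (Gamma_upd net k W p)) - noise * mip (Y W p) (Y W p * S W p))
     + 2 * mip (V p) (Lambda_at net k W p) - mip (V p) (L_at net k W p * V p))"

text \<open>Exchanging the sum over cochannel pairs turns the leakage caused by each slot into the
  power received by each slot, which together with the noise term forms
  \<open>J_mat\<close>.\<close>

lemma surr_slotwise:
  assumes W: "W \<in> beam_space net k" and V: "V \<in> beam_space net k"
  shows "surr W V = (\<Sum>p\<in>Act. \<rho> p *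
    (logdet (S W p) - (Re (tr (S W p)) - d p) + 2 * mip (direct_chan net k p * V p) (Y W p * S W p)
       - mip (Y W p) (J_mat net k V p * (Y W p * S W p))))"
proof -
  have "(\<Sum>p\<in>Act. mip (V p) (L_at net k W p * V p)) =
      (\<Sum>p\<in>Act. \<Sum>q\<in>{q \<in> Act. k q = k p}. \<rho> q * mip (Y W q) (rx_cov net k V q p * (Y W q * S W q)))"
    by (rule sum.cong) (auto simp: mip_L[OF W _ V] cochannel_def)
  also have "\<dots> = (\<Sum>q\<in>Act. \<Sum>p\<in>{p \<in> Act. k q = k p}.
      \<rho> q * mip (Y W q) (rx_cov net k V q p * (Y W q * S W q)))"
    by (rule sum.swap_restrict[OF finite_Act finite_Act])
  also have "\<dots> = (\<Sum>q\<in>Act. \<rho> q * (mip (Y W q) (J_mat net k V q * (Y W q * S W q))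
      - noise * mip (Y W q) (Y W q * S W q)))"
  proof (rule sum.cong[OF refl])
    fix q assume q: "q \<in> Act"
    have c: "Y W q * S W q \<in> carrier_mat rx (d q)"
      by (rule mult_carrier_mat[OF Y_carrier[OF W q] posdefD(1)[OF S_posdef[OF W q]]])
    have "{p \<in> Act. k q = k p} = co q" by (auto simp: cochannel_def)
    then show "(\<Sum>p\<in>{p \<in> Act. k q = k p}. \<rho> q * mip (Y W q) (rx_cov net k V q p * (Y W q * S W q))) =
        \<rho> q * (mip (Y W q) (J_mat net k V q * (Y W q * S W q)) - noise * mip (Y W q) (Y W q * S W q))"
      by (simp only: mip_J[OF V q Y_carrier[OF W q] c] sum_distrib_left add_diff_cancel)
  qed
  finally have L: "(\<Sum>p\<in>Act. mip (V p) (L_at net k W p * V p)) =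
    (\<Sum>p\<in>Act. \<rho> p * (mip (Y W p) (J_mat net k V p * (Y W p * S W p))
      - noise * mip (Y W p) (Y W p * S W p)))" .
  have "surr W V = (\<Sum>p\<in>Act. \<rho> p * (logdet (S W p) - (Re (tr (S W p)) - d p)
      - noise * mip (Y W p) (Y W p * S W p)) + 2 * (\<rho> p * mip (direct_chan net k p * V p) (Y W p * S W p)))
      - (\<Sum>p\<in>Act. mip (V p) (L_at net k W p * V p))"
    unfolding surr_def sum_subtractf
    by (intro arg_cong2[where f = "(-)"] sum.cong refl)
      (simp only: tr_Gamma_upd[OF W] mip_Lambda[OF W _ beam_carrier[OF V]])
  also have "\<dots> = (\<Sum>p\<in>Act. \<rho> p *
    (logdet (S W p) - (Re (tr (S W p)) - d p) + 2 * mip (direct_chan net k p * V p) (Y W p * S W p)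
       - mip (Y W p) (J_mat net k V p * (Y W p * S W p))))"
    unfolding L sum_subtractf[symmetric] by (rule sum.cong[OF refl]) (simp only: algebra_simps)
  finally show ?thesis .
qed

lemma surr_le_wsr:
  assumes W: "W \<in> beam_space net k" and V: "V \<in> beam_space net k"
  shows "surr W V \<le> wsr net k V"
  unfolding surr_slotwise[OF assms] wsr_def
  by (intro sum_mono mult_left_mono rate_le[OF V] weight_nonneg S_posdef[OF W] Y_carrier[OF W])

lemma surr_self:
  assumes W: "W \<in> beam_space net k"
  shows "surr W W = wsr net k W"
  unfolding surr_slotwise[OF W W] wsr_def by (intro sum.cong refl) (simp only: rate_eq[OF W])

text \<open>The direction \<open>\<Lambda> - L W\<close> is half the gradient at \<open>W\<close> of the surrogate built at \<open>W\<close>.\<close>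

definition Dir :: "mat_family \<Rightarrow> slot \<Rightarrow> complex mat" where
  "Dir W p = Lambda_at net k W p - L_at net k W p * W p"

lemma Dir_carrier:
  assumes "W \<in> beam_space net k" "p \<in> Act"
  shows "Dir W p \<in> carrier_mat tx (d p)"
  unfolding Dir_def
  by (intro minus_carrier_mat mult_carrier_mat[OF L_carrier] beam_carrier assms)

text \<open>\<open>surr W\<close> is quadratic in its second argument. With
  \<open>D = V p - W p\<close> its expansion around \<open>W\<close> has first-order term
  \<open>2 * mip D (Dir W p)\<close> and exact remainder \<open>- mip D (L * D)\<close>, which the
  eigenvalue bound controls by \<open>l p\<close>.\<close>

lemma surr_ascent:
  assumes W: "W \<in> beam_space net k" and V: "V \<in> beam_space net k"
    and l: "\<And>p. p \<in> Act \<Longrightarrow> lambda_max (L_at net k W p) \<le> l p"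
  shows "surr W W + (\<Sum>p\<in>Act. 2 * mip (V p - W p) (Dir W p) - l p * mip (V p - W p) (V p - W p)) \<le> surr W V"
  unfolding surr_def sum.distrib[symmetric]
proof (rule sum_mono)
  fix p assume p: "p \<in> Act"
  define L where "L = L_at net k W p"
  define Lam where "Lam = Lambda_at net k W p"
  define D where "D = V p - W p"
  note Vp = beam_carrier[OF V p] and Wp = beam_carrier[OF W p]
  have L: "L \<in> carrier_mat tx tx" using L_carrier[OF W p] by (simp add: L_def)
  have Lam: "Lam \<in> carrier_mat tx (d p)" using Lambda_carrier[OF W p] by (simp add: Lam_def)
  have D: "D \<in> carrier_mat tx (d p)" unfolding D_def by (rule minus_carrier_mat[OF Wp])
  have LV: "L * V p \<in> carrier_mat tx (d p)" and LW: "L * W p \<in> carrier_mat tx (d p)"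
    by (rule mult_carrier_mat[OF L Vp], rule mult_carrier_mat[OF L Wp])
  have "mip D (L * D) \<le> l p * mip D D"
    using mip_le_lambda_max[OF L_carrier[OF W p] L_hermitian[OF W p] l[OF p] D] by (simp add: L_def)
  moreover have "mip (W p) (L * V p) = mip (V p) (L * W p)"
    using mip_mult_left[OF L Wp Vp] L_hermitian[OF W p] mip_commute[OF LW Vp] by (simp add: L_def)
  moreover have "L * D = L * V p - L * W p"
    unfolding D_def by (rule mult_minus_distrib_mat[OF L Vp Wp])
  then have "mip D (L * D) = mip (V p) (L * V p) - mip (V p) (L * W p) - (mip (W p) (L * V p) - mip (W p) (L * W p))"
    using Vp Wp LV LW by (simp add: D_def mip_diff_left[of _ tx "d p"] mip_diff_right[of _ tx "d p"])
  moreover have "mip D (Dir W p) = mip (V p) Lam - mip (V p) (L * W p) - (mip (W p) Lam - mip (W p) (L * W p))"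
    unfolding D_def Dir_def L_def[symmetric] Lam_def[symmetric]
    using Vp Wp LW Lam by (simp add: mip_diff_left[of _ tx "d p"] mip_diff_right[of _ tx "d p"])
  ultimately show "\<rho> p * (logdet (S W p) - Re (tr (Gamma_upd net k W p)) - noise * mip (Y W p) (Y W p * S W p))
     + 2 * mip (W p) (Lambda_at net k W p) - mip (W p) (L_at net k W p * W p)
     + (2 * mip (V p - W p) (Dir W p) - l p * mip (V p - W p) (V p - W p))
     \<le> \<rho> p * (logdet (S W p) - Re (tr (Gamma_upd net k W p)) - noise * mip (Y W p) (Y W p * S W p))
     + 2 * mip (V p) (Lambda_at net k W p) - mip (V p) (L_at net k W p * V p)"
    unfolding L_def[symmetric] Lam_def[symmetric] D_def[symmetric] by linarith
qed

end

section \<open>Entrywise limits of matrices\<close>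

text \<open>The shape is fixed along the sequence and at the limit, since the index formulas for
  products, determinants and minors hold only for matching dimensions.\<close>

definition mat_lim :: "nat \<Rightarrow> nat \<Rightarrow> (nat \<Rightarrow> complex mat) \<Rightarrow> complex mat \<Rightarrow> bool" where
  "mat_lim n m X A \<longleftrightarrow> A \<in> carrier_mat n m \<and> (\<forall>t. X t \<in> carrier_mat n m) \<and>
     (\<forall>i<n. \<forall>j<m. (\<lambda>t. X t $$ (i, j)) \<longlonglongrightarrow> A $$ (i, j))"

lemma mat_limI:
  assumes "A \<in> carrier_mat n m" "\<And>t. X t \<in> carrier_mat n m"
    "\<And>i j. i < n \<Longrightarrow> j < m \<Longrightarrow> (\<lambda>t. X t $$ (i, j)) \<longlonglongrightarrow> A $$ (i, j)"
  shows "mat_lim n m X A"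
  using assms by (auto simp: mat_lim_def)

lemma mat_limD:
  assumes "mat_lim n m X A"
  shows "A \<in> carrier_mat n m" "X t \<in> carrier_mat n m"
    "i < n \<Longrightarrow> j < m \<Longrightarrow> (\<lambda>t. X t $$ (i, j)) \<longlonglongrightarrow> A $$ (i, j)"
  using assms by (auto simp: mat_lim_def)

lemma mat_lim_const: "A \<in> carrier_mat n m \<Longrightarrow> mat_lim n m (\<lambda>_. A) A"
  by (rule mat_limI) auto

lemma mat_lim_cong_index:
  assumes "B \<in> carrier_mat n m" "\<And>t. Z t \<in> carrier_mat n m"
    "\<And>i j. i < n \<Longrightarrow> j < m \<Longrightarrow> B $$ (i, j) = f i j" "\<And>t i j. i < n \<Longrightarrow> j < m \<Longrightarrow> Z t $$ (i, j) = g t i j"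
    "\<And>i j. i < n \<Longrightarrow> j < m \<Longrightarrow> (\<lambda>t. g t i j) \<longlonglongrightarrow> f i j"
  shows "mat_lim n m Z B"
  using assms by (auto intro!: mat_limI)

lemma mat_lim_add:
  assumes X: "mat_lim n m X A" and Y: "mat_lim n m Y B"
  shows "mat_lim n m (\<lambda>t. X t + Y t) (A + B)"
  by (rule mat_lim_cong_index[where f = "\<lambda>i j. A $$ (i, j) + B $$ (i, j)"
        and g = "\<lambda>t i j. X t $$ (i, j) + Y t $$ (i, j)"])
    (use mat_limD(1,2)[OF X] mat_limD(1,2)[OF Y] carrier_matD[OF mat_limD(2)[OF X]]
        carrier_matD[OF mat_limD(2)[OF Y]] in
      \<open>auto intro!: tendsto_add mat_limD(3)[OF X] mat_limD(3)[OF Y]\<close>)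

lemma mat_lim_diff:
  assumes X: "mat_lim n m X A" and Y: "mat_lim n m Y B"
  shows "mat_lim n m (\<lambda>t. X t - Y t) (A - B)"
  by (rule mat_lim_cong_index[where f = "\<lambda>i j. A $$ (i, j) - B $$ (i, j)"
        and g = "\<lambda>t i j. X t $$ (i, j) - Y t $$ (i, j)"])
    (use mat_limD(1,2)[OF X] mat_limD(1,2)[OF Y] carrier_matD[OF mat_limD(2)[OF X]]
        carrier_matD[OF mat_limD(2)[OF Y]] in
      \<open>auto intro!: tendsto_diff mat_limD(3)[OF X] mat_limD(3)[OF Y]\<close>)

lemma mat_lim_smult:
  assumes c: "c \<longlonglongrightarrow> e" and X: "mat_lim n m X A"
  shows "mat_lim n m (\<lambda>t. c t \<cdot>\<^sub>m X t) (e \<cdot>\<^sub>m A)"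
  by (rule mat_lim_cong_index[where f = "\<lambda>i j. e * A $$ (i, j)"
        and g = "\<lambda>t i j. c t * X t $$ (i, j)"])
    (use mat_limD(1,2)[OF X] carrier_matD[OF mat_limD(2)[OF X]] in \<open>auto intro!: tendsto_mult c mat_limD(3)[OF X]\<close>)

lemma mat_lim_adjoint:
  assumes X: "mat_lim n m X A"
  shows "mat_lim m n (\<lambda>t. mat_adjoint (X t)) (mat_adjoint A)"
  by (rule mat_lim_cong_index[where f = "\<lambda>i j. cnj (A $$ (j, i))" and g = "\<lambda>t i j. cnj (X t $$ (j, i))"])
    (use mat_limD(1,2)[OF X] carrier_matD[OF mat_limD(2)[OF X]] in \<open>auto intro!: tendsto_cnj mat_limD(3)[OF X]\<close>)

lemma mult_mat_index_sum:
  fixes A B :: "complex mat"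
  assumes "A \<in> carrier_mat n m" "B \<in> carrier_mat m l" "i < n" "j < l"
  shows "(A * B) $$ (i, j) = (\<Sum>x<m. A $$ (i, x) * B $$ (x, j))"
  using assms by (auto simp: scalar_prod_def atLeast0LessThan)

lemma mat_lim_mult:
  assumes X: "mat_lim n m X A" and Y: "mat_lim m l Y B"
  shows "mat_lim n l (\<lambda>t. X t * Y t) (A * B)"
proof (rule mat_lim_cong_index)
  show "A * B \<in> carrier_mat n l" "X t * Y t \<in> carrier_mat n l" for t
    using mat_limD(1,2)[OF X] mat_limD(1,2)[OF Y] by (auto intro: mult_carrier_mat)
  show "(A * B) $$ (i, j) = (\<Sum>x<m. A $$ (i, x) * B $$ (x, j))" if "i < n" "j < l" for i j
    by (rule mult_mat_index_sum[OF mat_limD(1)[OF X] mat_limD(1)[OF Y] that])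
  show "(X t * Y t) $$ (i, j) = (\<Sum>x<m. X t $$ (i, x) * Y t $$ (x, j))" if "i < n" "j < l" for t i j
    by (rule mult_mat_index_sum[OF mat_limD(2)[OF X] mat_limD(2)[OF Y] that])
  show "(\<lambda>t. \<Sum>x<m. X t $$ (i, x) * Y t $$ (x, j)) \<longlonglongrightarrow> (\<Sum>x<m. A $$ (i, x) * B $$ (x, j))"
    if "i < n" "j < l" for i j
    using that by (intro tendsto_sum tendsto_mult mat_limD(3)[OF X] mat_limD(3)[OF Y]) auto
qed

lemma mat_lim_msum:
  assumes X: "\<And>x. x \<in> I \<Longrightarrow> mat_lim n m (\<lambda>t. X t x) (A x)"
  shows "mat_lim n m (\<lambda>t. msum n m (X t) I) (msum n m A I)"
  by (rule mat_lim_cong_index[where f = "\<lambda>i j. \<Sum>x\<in>I. A x $$ (i, j)"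
        and g = "\<lambda>t i j. \<Sum>x\<in>I. X t x $$ (i, j)"])
    (auto simp: msum_def intro!: tendsto_sum mat_limD(3)[OF X])

section \<open>Continuity of the determinant and of the inverse\<close>

lemma tendsto_det:
  assumes X: "mat_lim n n X A"
  shows "(\<lambda>t. det (X t)) \<longlonglongrightarrow> det A"
proof -
  have "(\<lambda>t. \<Sum>p | p permutes {0..<n}. signof p * (\<Prod>i = 0..<n. X t $$ (i, p i)))
      \<longlonglongrightarrow> (\<Sum>p | p permutes {0..<n}. signof p * (\<Prod>i = 0..<n. A $$ (i, p i)))"
    by (intro tendsto_sum tendsto_mult tendsto_const tendsto_prod mat_limD(3)[OF X])
      (auto dest: permutes_in_image)
  then show ?thesis
    using det_def'[OF mat_limD(1)[OF X]] det_def'[OF mat_limD(2)[OF X]] by simp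
qed

lemma mat_lim_adj_mat:
  assumes X: "mat_lim n n X A"
  shows "mat_lim n n (\<lambda>t. adj_mat (X t)) (adj_mat A)"
proof (rule mat_lim_cong_index)
  show "adj_mat A \<in> carrier_mat n n" "adj_mat (X t) \<in> carrier_mat n n" for t
    using adj_mat(1) mat_limD(1,2)[OF X] by auto
  show "adj_mat A $$ (i, j) = (-1) ^ (j + i) * det (mat_delete A j i)" if "i < n" "j < n" for i j
    using mat_limD(1)[OF X] that by (auto simp: adj_mat_def cofactor_def)
  show "adj_mat (X t) $$ (i, j) = (-1) ^ (j + i) * det (mat_delete (X t) j i)" if "i < n" "j < n" for t i j
    using mat_limD(2)[OF X, of t] that by (auto simp: adj_mat_def cofactor_def)
  fix i j assume ij: "i < n" "j < n"
  have "mat_lim (n - 1) (n - 1) (\<lambda>t. mat_delete (X t) j i) (mat_delete A j i)"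
  proof (rule mat_lim_cong_index)
    \<comment> \<open>Deleting row \<open>j\<close> and column \<open>i\<close> shifts the later
      indices by one.\<close>
    let ?e = "\<lambda>a b. (if a < j then a else Suc a, if b < i then b else Suc b)"
    show "mat_delete A j i \<in> carrier_mat (n - 1) (n - 1)" "mat_delete (X t) j i \<in> carrier_mat (n - 1) (n - 1)" for t
      by (rule mat_delete_carrier, rule mat_limD[OF X])+
    show "mat_delete A j i $$ (a, b) = A $$ ?e a b" if "a < n - 1" "b < n - 1" for a b
      using mat_limD(1)[OF X] that by (auto simp: mat_delete_def)
    show "mat_delete (X t) j i $$ (a, b) = X t $$ ?e a b" if "a < n - 1" "b < n - 1" for t a b
      using mat_limD(2)[OF X, of t] that by (auto simp: mat_delete_def)
    show "(\<lambda>t. X t $$ ?e a b) \<longlonglongrightarrow> A $$ ?e a b" if "a < n - 1" "b < n - 1" for a b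
      using that by (intro mat_limD(3)[OF X]) auto
  qed
  then show "(\<lambda>t. (-1) ^ (j + i) * det (mat_delete (X t) j i)) \<longlonglongrightarrow> (-1) ^ (j + i) * det (mat_delete A j i)"
    by (intro tendsto_mult tendsto_const tendsto_det)
qed

text \<open>Cramer's rule: each entry of the inverse is a polynomial in the entries divided by the
  determinant, hence continuous where the determinant is nonzero.\<close>

lemma minv_adj_mat:
  assumes A: "A \<in> carrier_mat n n" and d: "det A \<noteq> 0"
  shows "minv A = inverse (det A) \<cdot>\<^sub>m adj_mat A"
proof -
  note i = minv[OF A d] and a = adj_mat[OF A]
  have "minv A * (A * adj_mat A) = det A \<cdot>\<^sub>m minv A"
    unfolding a(2) using i(3) by (simp add: mult_smult_distrib[of _ n n _ n])
  moreover have "minv A * (A * adj_mat A) = minv A * A * adj_mat A"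
    by (rule mat_mult_assoc[symmetric]) (use i(3) A a(1) in auto)
  moreover have "\<dots> = adj_mat A" unfolding i(2) using a(1) by simp
  ultimately have e: "adj_mat A = det A \<cdot>\<^sub>m minv A" by simp
  show ?thesis unfolding e using d by (intro eq_matI) auto
qed

lemma mat_lim_minv:
  assumes X: "mat_lim n n X A" and "det A \<noteq> 0" and "\<And>t. det (X t) \<noteq> 0"
  shows "mat_lim n n (\<lambda>t. minv (X t)) (minv A)"
  using mat_lim_smult[OF tendsto_inverse[OF tendsto_det[OF X] assms(2)] mat_lim_adj_mat[OF X]]
  by (simp add: minv_adj_mat[OF mat_limD(1)[OF X] assms(2)] minv_adj_mat[OF mat_limD(2)[OF X] assms(3)])

lemma tendsto_mip:
  assumes X: "mat_lim n m X A" and Y: "mat_lim n m Y B"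
  shows "(\<lambda>t. mip (X t) (Y t)) \<longlonglongrightarrow> mip A B"
  unfolding mip_expand[OF mat_limD(2)[OF X] mat_limD(2)[OF Y]] mip_expand[OF mat_limD(1)[OF X] mat_limD(1)[OF Y]]
    case_prod_unfold
  by (intro tendsto_sum tendsto_Re tendsto_mult tendsto_cnj mat_limD(3)[OF X] mat_limD(3)[OF Y]) auto

section \<open>Projection onto the power ball\<close>

text \<open>The third claim is the obtuse angle property of the projection onto a convex set. The
  projection is \<open>c\<close> times \<open>X\<close>, so the inner product factors as
  \<open>(1 - c) * (mip X U - c * x)\<close>; it vanishes if \<open>X\<close> is in the ball, and
  otherwise \<open>c\<close> times \<open>X\<close> lies on the sphere.\<close>

lemma proj_ball:
  assumes P: "0 < P" and X: "X \<in> carrier_mat n m"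
  shows "proj_ball P X \<in> carrier_mat n m"
    and "mip (proj_ball P X) (proj_ball P X) \<le> P"
    and "U \<in> carrier_mat n m \<Longrightarrow> mip U U \<le> P \<Longrightarrow> mip (X - proj_ball P X) (U - proj_ball P X) \<le> 0"
proof -
  define c where "c = min 1 (sqrt P / frob_norm X)"
  define x where "x = mip X X"
  have x0: "0 \<le> x" by (simp add: x_def mip_self_nonneg)
  have Z: "proj_ball P X = complex_of_real c \<cdot>\<^sub>m X" by (simp add: proj_ball_def c_def)
  show ZC: "proj_ball P X \<in> carrier_mat n m" using X by (simp add: Z)
  have ZZ: "mip (proj_ball P X) (proj_ball P X) = c * (c * x)"
    using X by (simp add: Z x_def mip_smult_left[of _ n m] mip_smult_right[of _ n m])
  \<comment> \<open>At \<open>x = 0\<close> division by zero gives \<open>c = 0\<close> and not 1,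
    so this case is listed separately.\<close>
  have cases: "(x \<le> P \<and> (x = 0 \<or> c = 1)) \<or> (c * (c * x) = P \<and> 0 < c \<and> c < 1)"
  proof (cases "x \<le> P")
    case True
    have "c = 1" if "x \<noteq> 0"
    proof -
      have "sqrt x \<le> sqrt P" using True by simp
      then have "1 \<le> sqrt P / sqrt x" using that x0 by simp
      then show ?thesis by (simp add: c_def frob_norm_eq x_def[symmetric])
    qed
    then show ?thesis using True by auto
  next
    case False
    then have "sqrt P < sqrt x" "0 < sqrt x" using P by auto
    then have "sqrt P / sqrt x < 1" "0 < sqrt P / sqrt x" using P by auto
    moreover from this have "c = sqrt P / sqrt x" by (simp add: c_def frob_norm_eq x_def[symmetric])
    moreover have "sqrt P / sqrt x * (sqrt P / sqrt x * x) = P"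
      using P False by (simp add: field_simps)
    ultimately show ?thesis by auto
  qed
  then show "mip (proj_ball P X) (proj_ball P X) \<le> P"
    unfolding ZZ using P by auto
  assume U: "U \<in> carrier_mat n m" "mip U U \<le> P"
  have e: "mip (X - proj_ball P X) (U - proj_ball P X) = (1 - c) * (mip X U - c * x)"
    using X U by (simp add: Z x_def mip_diff_left[of _ n m] mip_diff_right[of _ n m]
        mip_smult_left[of _ n m] mip_smult_right[of _ n m] algebra_simps)
  show "mip (X - proj_ball P X) (U - proj_ball P X) \<le> 0"
    using cases
  proof
    assume "x \<le> P \<and> (x = 0 \<or> c = 1)"
    moreover have "mip X U = 0" if "x = 0"
      using mip_Cauchy_Schwarz[OF X U(1)] that by (simp add: x_def)
    ultimately show ?thesis unfolding e by auto
  next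
    assume c: "c * (c * x) = P \<and> 0 < c \<and> c < 1"
    \<comment> \<open>Expanding the square with \<open>|c X|^2 = P\<close> and
      \<open>|U|^2 <= P\<close> bounds the cross term.\<close>
    have "0 \<le> mip (complex_of_real c \<cdot>\<^sub>m X - U) (complex_of_real c \<cdot>\<^sub>m X - U)" by (rule mip_self_nonneg)
    also have "\<dots> = c * (c * x) - 2 * (c * mip X U) + mip U U"
      using X U mip_commute[OF U(1) X] by (simp add: x_def mip_diff_left[of _ n m] mip_diff_right[of _ n m]
        mip_smult_left[of _ n m] mip_smult_right[of _ n m] algebra_simps)
    finally have "c * mip X U \<le> c * (c * x)" using c U(2) by simp
    then have "mip X U \<le> c * x" using c mult_le_cancel_left_pos[of c "mip X U" "c * x"] by blast
    then show ?thesis unfolding e using c by (intro mult_nonneg_nonpos) auto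
  qed
qed

section \<open>The relaxed iteration\<close>

context rbg_network
begin

abbreviation "P \<equiv> power_budget net"

lemma P_pos: "0 < P"
  using net by (simp add: valid_network_def)

lemma feasible_iff: "feasible net k V \<longleftrightarrow> V \<in> beam_space net k \<and> (\<forall>p\<in>Act. mip (V p) (V p) \<le> P)"
  by (auto simp: feasible_def frob_norm_eq mip_self_nonneg)

lemma wsr_bounded: "\<exists>B. \<forall>V. feasible net k V \<longrightarrow> wsr net k V \<le> B"
proof (intro exI allI impI)
  fix V assume V: "feasible net k V"
  show "wsr net k V \<le> (\<Sum>p\<in>Act. \<rho> p * (mip (direct_chan net k p) (direct_chan net k p) * P / noise))"
    unfolding wsr_def
  proof (intro sum_mono mult_left_mono)
    fix p assume p: "p \<in> Act"
    have V': "V \<in> beam_space net k" "mip (V p) (V p) \<le> P" using V p by (auto simp: feasible_iff)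
    have "mip (direct_chan net k p * V p) (direct_chan net k p * V p)
        \<le> mip (direct_chan net k p) (direct_chan net k p) * mip (V p) (V p)"
      by (rule mip_mult_self_le[OF chan_carrier[OF p p] beam_carrier[OF V'(1) p]])
    also have "\<dots> \<le> mip (direct_chan net k p) (direct_chan net k p) * P"
      by (intro mult_left_mono V'(2) mip_self_nonneg)
    finally show "logdet (S V p) \<le> mip (direct_chan net k p) (direct_chan net k p) * P / noise"
      using logdet_S_le[OF V'(1) p] noise_pos by (meson divide_right_mono order_trans less_imp_le)
  qed (auto simp: weight_nonneg)
qed

text \<open>Relaxation only rescales the correction by \<open>a\<close>, so the step is a projected
  gradient step along \<open>Dir\<close> with factor \<open>a / l\<close>.\<close>

lemma relaxed_step_eq:
  assumes W: "W \<in> beam_space net k" and p: "p \<in> Act"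
  shows "relaxed_step net k l a W p = proj_ball P (W p + complex_of_real (a / l) \<cdot>\<^sub>m Dir W p)"
proof -
  have "Z + complex_of_real a \<cdot>\<^sub>m (Z + complex_of_real (1 / l) \<cdot>\<^sub>m D - Z) = Z + complex_of_real (a / l) \<cdot>\<^sub>m D"
    if "Z \<in> carrier_mat n m" "D \<in> carrier_mat n m" for Z D n m
    using that by (intro eq_matI) auto
  from this[OF beam_carrier[OF W p] Dir_carrier[OF W p]] show ?thesis
    unfolding relaxed_step_def fp_point_def Dir_def by simp
qed

section \<open>One projected step\<close>

context
  fixes W p and l a :: real
  assumes W: "W \<in> beam_space net k" and p: "p \<in> Act" and l: "0 < l" and a: "0 < a"
begin

abbreviation "W' \<equiv> relaxed_step net k l a W p"

lemma relaxed_arg_carrier: "W p + complex_of_real (a / l) \<cdot>\<^sub>m Dir W p \<in> carrier_mat tx (d p)"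
  using beam_carrier[OF W p] Dir_carrier[OF W p] by simp

lemma step_carrier: "W' \<in> carrier_mat tx (d p)"
  unfolding relaxed_step_eq[OF W p] by (rule proj_ball(1)[OF P_pos relaxed_arg_carrier])

lemma step_power: "mip W' W' \<le> P"
  unfolding relaxed_step_eq[OF W p] by (rule proj_ball(2)[OF P_pos relaxed_arg_carrier])

text \<open>The obtuse angle property at the projected point, multiplied by
  \<open>l\<close>.\<close>

lemma step_variational:
  assumes U: "U \<in> carrier_mat tx (d p)" "mip U U \<le> P"
  shows "a * mip (Dir W p) (U - W') \<le> l * mip (W' - W p) (U - W')"
proof -
  note c = beam_carrier[OF W p] Dir_carrier[OF W p] step_carrier
  have UW: "U - W' \<in> carrier_mat tx (d p)" by (rule minus_carrier_mat[OF step_carrier])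
  have cD: "complex_of_real (a / l) \<cdot>\<^sub>m Dir W p \<in> carrier_mat tx (d p)" using c by simp
  have "mip (W p + complex_of_real (a / l) \<cdot>\<^sub>m Dir W p - W') (U - W') \<le> 0"
    using proj_ball(3)[OF P_pos relaxed_arg_carrier U] unfolding relaxed_step_eq[OF W p] .
  also have "mip (W p + complex_of_real (a / l) \<cdot>\<^sub>m Dir W p - W') (U - W') =
      mip (W p) (U - W') + a / l * mip (Dir W p) (U - W') - mip W' (U - W')"
    unfolding mip_diff_left[OF relaxed_arg_carrier c(3) UW] mip_add_left[OF c(1) cD UW]
      mip_smult_left[OF c(2) UW] ..
  finally have "a / l * mip (Dir W p) (U - W') \<le> mip (W' - W p) (U - W')"
    using mip_diff_left[OF c(3,1) UW] by simp
  then have "l * (a / l * mip (Dir W p) (U - W')) \<le> l * mip (W' - W p) (U - W')"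
    using l by (intro mult_left_mono) auto
  then show ?thesis using l by simp
qed

text \<open>Tests the variational inequality with the current block \<open>U = W p\<close>, which
  lies in the ball.\<close>

lemma step_descent:
  assumes "mip (W p) (W p) \<le> P"
  shows "l * mip (W' - W p) (W' - W p) \<le> a * mip (W' - W p) (Dir W p)"
proof -
  note c = beam_carrier[OF W p] Dir_carrier[OF W p] step_carrier
  have D: "W' - W p \<in> carrier_mat tx (d p)" by (rule minus_carrier_mat[OF c(1)])
  have swap: "mip Z (W p - W') = - mip Z (W' - W p)" if "Z \<in> carrier_mat tx (d p)" for Z
    using mip_diff_right[OF that c(1,3)] mip_diff_right[OF that c(3,1)] by simp
  show ?thesis
    using step_variational[OF c(1) assms] swap[OF c(2)] swap[OF D] mip_commute[OF D c(2)] by simp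
qed

end

text \<open>\<open>hi < 2\<close> keeps \<open>2 / hi - 1\<close> positive in the ascent estimate;
  \<open>0 < lo\<close> permits uniform division by the relaxation factor in the asymptotic
  inequality.\<close>

lemma compact_relaxation_bounds:
  fixes C :: "real set"
  assumes "compact C" "C \<subseteq> {0<..<2}"
  shows "\<exists>lo hi. 0 < lo \<and> 0 < hi \<and> hi < 2 \<and> (\<forall>x\<in>C. lo \<le> x \<and> x \<le> hi)"
proof (cases "C = {}")
  case True
  then show ?thesis by (intro exI[of _ 1]) auto
next
  case False
  obtain lo hi where "lo \<in> C" "\<forall>x\<in>C. lo \<le> x" "hi \<in> C" "\<forall>x\<in>C. x \<le> hi"
    using compact_attains_inf[OF assms(1) False] compact_attains_sup[OF assms(1) False] by blast
  then show ?thesis using assms(2) by (intro exI[of _ lo] exI[of _ hi]) auto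
qed

end

locale relaxed_iteration = rbg_network +
  fixes V :: "nat \<Rightarrow> mat_family" and lam alpha :: "nat \<Rightarrow> slot \<Rightarrow> real" and C :: "real set"
  assumes init: "feasible net k (V 0)"
    and iter: "\<And>\<tau> p. 1 \<le> \<tau> \<Longrightarrow> p \<in> Act \<Longrightarrow>
                 V \<tau> p = relaxed_step net k (lam \<tau> p) (alpha \<tau> p) (V (\<tau> - 1)) p"
    and lam_pos: "\<And>\<tau> p. 1 \<le> \<tau> \<Longrightarrow> p \<in> Act \<Longrightarrow> 0 < lam \<tau> p"
    and lam_ge: "\<And>\<tau> p. 1 \<le> \<tau> \<Longrightarrow> p \<in> Act \<Longrightarrow> lambda_max (L_at net k (V (\<tau> - 1)) p) \<le> lam \<tau> p"
    and alpha_compact: "compact C" "C \<subseteq> {0<..<2}"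
    and alpha_in: "\<And>\<tau> p. 1 \<le> \<tau> \<Longrightarrow> p \<in> Act \<Longrightarrow> alpha \<tau> p \<in> C"
begin

abbreviation "l n p \<equiv> lam (Suc n) p"
abbreviation "a n p \<equiv> alpha (Suc n) p"
abbreviation "\<Delta> n p \<equiv> V (Suc n) p - V n p"

lemma V_Suc: "p \<in> Act \<Longrightarrow> V (Suc n) p = relaxed_step net k (l n p) (a n p) (V n) p"
  using iter[of "Suc n" p] by simp

lemma l_pos: "p \<in> Act \<Longrightarrow> 0 < l n p"
  using lam_pos by simp

lemma a_pos: "p \<in> Act \<Longrightarrow> 0 < a n p"
  using alpha_in[of "Suc n" p] alpha_compact(2) by force

lemma V_feasible: "feasible net k (V n)"
proof (induction n)
  case (Suc n)
  then have W: "V n \<in> beam_space net k" by (simp add: feasible_iff)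
  show ?case
    unfolding feasible_iff beam_space_def
    using step_carrier[OF W] step_power[OF W] l_pos a_pos by (simp add: V_Suc)
qed (rule init)

lemma V_beam: "V n \<in> beam_space net k" and V_power: "p \<in> Act \<Longrightarrow> mip (V n p) (V n p) \<le> P"
  using V_feasible[of n] by (simp_all add: feasible_iff)

lemma Delta_carrier: "p \<in> Act \<Longrightarrow> \<Delta> n p \<in> carrier_mat tx (d p)"
  by (rule minus_carrier_mat[OF beam_carrier[OF V_beam]])

text \<open>\<open>2 * slope n p - energy n p\<close> is the ascent that slot \<open>p\<close>
  contributes in \<open>surr_ascent\<close>.\<close>

abbreviation "energy n p \<equiv> l n p * mip (\<Delta> n p) (\<Delta> n p)"
abbreviation "slope n p \<equiv> mip (\<Delta> n p) (Dir (V n) p)"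

lemma energy_nonneg: "p \<in> Act \<Longrightarrow> 0 \<le> energy n p"
  using l_pos[of p n] by (simp add: mip_self_nonneg less_imp_le)

lemma energy_le_slope: "p \<in> Act \<Longrightarrow> energy n p \<le> a n p * slope n p"
  using step_descent[OF V_beam _ l_pos a_pos V_power] by (simp add: V_Suc)

lemma gain_ge: "\<exists>c>0. \<forall>n. \<forall>p\<in>Act. c * energy n p \<le> 2 * slope n p - energy n p"
proof -
  obtain lo hi where h: "0 < lo" "0 < hi" "hi < 2" "\<forall>x\<in>C. lo \<le> x \<and> x \<le> hi"
    using compact_relaxation_bounds[OF alpha_compact] by blast
  have "(2 / hi - 1) * energy n p \<le> 2 * slope n p - energy n p" if p: "p \<in> Act" for n p
  proof -
    have e: "0 \<le> energy n p" "energy n p \<le> a n p * slope n p"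
      using energy_nonneg[OF p] energy_le_slope[OF p] by auto
    \<comment> \<open>The sign of the slope is settled before \<open>a n p\<close> is replaced by
      the larger \<open>hi\<close>.\<close>
    have "0 \<le> slope n p" using e a_pos[OF p, of n] by (meson order_trans zero_le_mult_iff not_less)
    moreover have "a n p \<le> hi" using h alpha_in[of "Suc n" p] p by simp
    ultimately have "energy n p \<le> hi * slope n p"
      using e(2) mult_right_mono[of "a n p" hi "slope n p"] by linarith
    then have "energy n p / hi \<le> slope n p" using h by (simp add: pos_divide_le_eq mult.commute)
    then show ?thesis by (simp add: algebra_simps)
  qed
  moreover have "2 / hi - 1 > 0" using h by simp
  ultimately show ?thesis by blast
qed

lemma gain_nonneg: "p \<in> Act \<Longrightarrow> 0 \<le> 2 * slope n p - energy n p"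
proof -
  assume p: "p \<in> Act"
  obtain c where "c > 0" "c * energy n p \<le> 2 * slope n p - energy n p" using gain_ge p by blast
  moreover have "0 \<le> c * energy n p" using energy_nonneg[OF p] \<open>c > 0\<close> by simp
  ultimately show ?thesis by linarith
qed

lemma gain_le_wsr_diff:
  "(\<Sum>p\<in>Act. 2 * slope n p - energy n p) \<le> wsr net k (V (Suc n)) - wsr net k (V n)"
proof -
  have "\<And>p. p \<in> Act \<Longrightarrow> lambda_max (L_at net k (V n) p) \<le> l n p"
    using lam_ge[of "Suc n"] by simp
  from surr_ascent[OF V_beam V_beam[of "Suc n"] this]
  show ?thesis using surr_self[OF V_beam[of n]] surr_le_wsr[OF V_beam[of n] V_beam[of "Suc n"]] by linarith
qed

section \<open>Convergence of the objective and vanishing gains\<close>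

lemma wsr_convergent: "convergent (\<lambda>\<tau>. wsr net k (V \<tau>))"
proof -
  have inc: "incseq (\<lambda>\<tau>. wsr net k (V \<tau>))"
  proof (rule incseq_SucI)
    fix n
    have "0 \<le> (\<Sum>p\<in>Act. 2 * slope n p - energy n p)" by (intro sum_nonneg gain_nonneg)
    then show "wsr net k (V n) \<le> wsr net k (V (Suc n))" using gain_le_wsr_diff[of n] by linarith
  qed
  obtain B where "\<forall>n. wsr net k (V n) \<le> B" using wsr_bounded V_feasible by blast
  then obtain f where "(\<lambda>\<tau>. wsr net k (V \<tau>)) \<longlonglongrightarrow> f"
    by (rule incseq_convergent[OF inc])
  then show ?thesis by (rule convergentI)
qed

text \<open>The slot gains are nonnegative and their sum is at most an increment of a convergent
  sequence, so each gain tends to 0. It dominates a fixed multiple of the energy, and the slope is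
  half of gain plus energy.\<close>

lemma energy_slope_vanish:
  assumes p: "p \<in> Act"
  shows "(\<lambda>n. energy n p) \<longlonglongrightarrow> 0" "(\<lambda>n. slope n p) \<longlonglongrightarrow> 0"
proof -
  let ?g = "\<lambda>n. 2 * slope n p - energy n p"
  obtain f where f: "(\<lambda>\<tau>. wsr net k (V \<tau>)) \<longlonglongrightarrow> f" using wsr_convergent by (auto simp: convergent_def)
  have diff: "(\<lambda>n. wsr net k (V (Suc n)) - wsr net k (V n)) \<longlonglongrightarrow> 0"
    using tendsto_diff[OF LIMSEQ_Suc[OF f] f] by simp
  have g: "?g \<longlonglongrightarrow> 0"
  proof (rule tendsto_sandwich[OF always_eventually always_eventually tendsto_const diff])
    show "\<forall>n. 0 \<le> ?g n" using gain_nonneg[OF p] by simp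
    show "\<forall>n. ?g n \<le> wsr net k (V (Suc n)) - wsr net k (V n)"
    proof
      fix n
      have "?g n \<le> (\<Sum>p\<in>Act. 2 * slope n p - energy n p)"
        by (rule member_le_sum[OF p _ finite_Act]) (rule gain_nonneg, simp)
      also note gain_le_wsr_diff
      finally show "?g n \<le> wsr net k (V (Suc n)) - wsr net k (V n)" .
    qed
  qed
  obtain c where c: "c > 0" "\<And>n. c * energy n p \<le> ?g n" using gain_ge p by blast
  have gc: "(\<lambda>n. ?g n / c) \<longlonglongrightarrow> 0" using tendsto_divide[OF g tendsto_const, of c] c(1) by simp
  show e: "(\<lambda>n. energy n p) \<longlonglongrightarrow> 0"
  proof (rule tendsto_sandwich[OF always_eventually always_eventually tendsto_const gc])
    show "\<forall>n. 0 \<le> energy n p" using energy_nonneg[OF p] by simp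
    show "\<forall>n. energy n p \<le> ?g n / c"
    proof
      fix n
      show "energy n p \<le> ?g n / c"
        using c(1) c(2)[of n] by (simp add: pos_le_divide_eq mult.commute[of _ c])
    qed
  qed
  have "(\<lambda>n. (?g n + energy n p) / 2) \<longlonglongrightarrow> 0"
    using tendsto_divide[OF tendsto_add[OF g e] tendsto_const, of 2] by simp
  then show "(\<lambda>n. slope n p) \<longlonglongrightarrow> 0" by simp
qed

text \<open>Along the whole sequence the variational inequality holds up to a null sequence. The
  bound on the \<open>lam\<close> turns \<open>lam * \<parallel>\<Delta>\<parallel>\<^sup>2 \<rightarrow> 0\<close> into \<open>lam * \<parallel>\<Delta>\<parallel> \<rightarrow> 0\<close>; no lower bound on
  \<open>lam\<close> is available, so \<open>\<Delta>\<close> itself need not vanish.\<close>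

lemma asymptotic_variational:
  assumes p: "p \<in> Act" and B: "\<And>n. l n p \<le> B"
    and U: "U \<in> carrier_mat tx (d p)" "mip U U \<le> P"
  shows "\<exists>e. e \<longlonglongrightarrow> 0 \<and> (\<forall>n. mip (Dir (V n) p) (U - V n p) \<le> e n)"
proof -
  obtain lo hi where h: "0 < lo" "\<forall>x\<in>C. lo \<le> x \<and> x \<le> hi"
    using compact_relaxation_bounds[OF alpha_compact] by blast
  \<comment> \<open>\<open>4 * P\<close> bounds the squared distance of two points of the ball,
    \<open>lo\<close> comes from dividing by the relaxation factor, and the slope moves the base
    point from \<open>V (Suc n)\<close> back to \<open>V n\<close>.\<close>
  define e where "e n = sqrt (B * energy n p * (4 * P)) / lo + slope n p" for n
  have "e \<longlonglongrightarrow> sqrt (B * 0 * (4 * P)) / lo + 0"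
    unfolding e_def
    by (rule tendsto_add[OF tendsto_divide[OF tendsto_real_sqrt[OF tendsto_mult[OF
          tendsto_mult[OF tendsto_const energy_slope_vanish(1)[OF p]] tendsto_const]] tendsto_const]
        energy_slope_vanish(2)[OF p]]) (use h(1) in simp)
  moreover have "mip (Dir (V n) p) (U - V n p) \<le> e n" for n
  proof -
    note W = V_beam[of n] and W' = V_beam[of "Suc n"]
    note c = beam_carrier[OF W p] beam_carrier[OF W' p] Dir_carrier[OF W p] Delta_carrier[OF p, of n]
    define X where "X = U - V (Suc n) p"
    have X: "X \<in> carrier_mat tx (d p)" unfolding X_def by (rule minus_carrier_mat[OF c(2)])
    have a: "0 < a n p" "lo \<le> a n p" using a_pos[OF p] h(2) alpha_in[of "Suc n" p] p by auto
    have XX: "mip X X \<le> 4 * P"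
    proof -
      \<comment> \<open>Parallelogram law: dropping the square of the sum bounds the square of the
        difference.\<close>
      have "0 \<le> mip (U + V (Suc n) p) (U + V (Suc n) p)" by (rule mip_self_nonneg)
      moreover have "mip (U + V (Suc n) p) (U + V (Suc n) p) + mip X X
          = 2 * mip U U + 2 * mip (V (Suc n) p) (V (Suc n) p)"
        unfolding X_def using U(1) c(2)
        by (simp add: mip_add_left[of _ tx "d p"] mip_add_right[of _ tx "d p"]
            mip_diff_left[of _ tx "d p"] mip_diff_right[of _ tx "d p"])
      ultimately show ?thesis using U(2) V_power[OF p, of "Suc n"] by linarith
    qed
    have le: "a n p * mip (Dir (V n) p) X \<le> l n p * mip (\<Delta> n p) X"
      using step_variational[OF W p l_pos[OF p] a_pos[OF p] U, of n n] by (simp add: V_Suc[OF p] X_def)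
    note en = energy_nonneg[OF p, of n]
    have "0 \<le> B" using B[of n] l_pos[OF p, of n] by linarith
    then have Be: "0 \<le> B * energy n p" using en by (rule mult_nonneg_nonneg)
    \<comment> \<open>Of the two factors \<open>l n p\<close>, one is absorbed by the energy and the
      other is bounded by \<open>B\<close>.\<close>
    have "(l n p * mip (\<Delta> n p) X)\<^sup>2 \<le> (l n p)\<^sup>2 * (mip (\<Delta> n p) (\<Delta> n p) * mip X X)"
      using mip_Cauchy_Schwarz[OF c(4) X] by (simp add: power_mult_distrib mult_left_mono)
    also have "\<dots> = l n p * energy n p * mip X X" by (simp add: power2_eq_square)
    also have "\<dots> \<le> B * energy n p * (4 * P)"
      by (rule mult_mono[OF mult_right_mono[OF B en] XX Be mip_self_nonneg])
    finally have "l n p * mip (\<Delta> n p) X \<le> sqrt (B * energy n p * (4 * P))"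
      by (rule real_le_rsqrt)
    then have "a n p * mip (Dir (V n) p) X \<le> sqrt (B * energy n p * (4 * P))" using le by simp
    moreover have "0 \<le> sqrt (B * energy n p * (4 * P))"
      using mult_nonneg_nonneg[OF Be, of "4 * P"] P_pos by simp
    ultimately have "mip (Dir (V n) p) X \<le> sqrt (B * energy n p * (4 * P)) / a n p"
      using a by (simp add: pos_le_divide_eq mult.commute)
    also have "\<dots> \<le> sqrt (B * energy n p * (4 * P)) / lo"
      using a h(1) \<open>0 \<le> sqrt (B * energy n p * (4 * P))\<close> by (intro divide_left_mono) auto
    finally have "mip (Dir (V n) p) X \<le> sqrt (B * energy n p * (4 * P)) / lo" .
    moreover have "mip (Dir (V n) p) (U - V n p) = mip (Dir (V n) p) X + slope n p"
      unfolding X_def mip_commute[OF c(4,3)]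
      using c U(1) by (simp add: mip_diff_right[of _ tx "d p"])
    ultimately show ?thesis by (simp add: e_def)
  qed
  ultimately show ?thesis by auto
qed

end

section \<open>Accumulation points\<close>

context rbg_network
begin

section \<open>Continuity of the updates and of the direction\<close>

context
  fixes X :: "nat \<Rightarrow> mat_family" and A :: mat_family
  assumes X: "\<And>t. X t \<in> beam_space net k" and A: "A \<in> beam_space net k"
    and lim: "\<And>p. p \<in> Act \<Longrightarrow> mat_lim tx (d p) (\<lambda>t. X t p) (A p)"
begin

lemma mat_lim_chan: "p \<in> Act \<Longrightarrow> q \<in> Act \<Longrightarrow> mat_lim rx tx (\<lambda>_. chan_from net k q p) (chan_from net k q p)"
  by (rule mat_lim_const[OF chan_carrier])

lemma mat_lim_rx_cov:
  assumes "p \<in> Act" "q \<in> Act"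
  shows "mat_lim rx rx (\<lambda>t. rx_cov net k (X t) p q) (rx_cov net k A p q)"
  unfolding rx_cov_def
  by (rule mat_lim_mult[OF mat_lim_mult[OF mat_lim_mult[OF mat_lim_chan[OF assms] lim[OF assms(2)]]
        mat_lim_adjoint[OF lim[OF assms(2)]]] mat_lim_adjoint[OF mat_lim_chan[OF assms]]])

lemma mat_lim_M:
  assumes p: "p \<in> Act"
  shows "mat_lim rx rx (\<lambda>t. M_mat net k (X t) p) (M_mat net k A p)"
  unfolding M_mat_def
  by (intro mat_lim_add mat_lim_msum mat_lim_rx_cov[OF p] mat_lim_const) (auto intro: co_Act)

lemma mat_lim_J:
  assumes p: "p \<in> Act"
  shows "mat_lim rx rx (\<lambda>t. J_mat net k (X t) p) (J_mat net k A p)"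
  unfolding J_mat_def by (rule mat_lim_add[OF mat_lim_rx_cov[OF p p] mat_lim_M[OF p]])

text \<open>The noise keeps the covariance positive definite along the sequence and at the limit, so
  the inverse does not degenerate.\<close>

lemma mat_lim_minv_M:
  assumes p: "p \<in> Act"
  shows "mat_lim rx rx (\<lambda>t. minv (M_mat net k (X t) p)) (minv (M_mat net k A p))"
  by (rule mat_lim_minv[OF mat_lim_M[OF p]];
      rule posdef_det_nonzero[OF slot_covariance.M_posdef[OF slot[OF _ p]]], rule X A)

lemma mat_lim_minv_J:
  assumes p: "p \<in> Act"
  shows "mat_lim rx rx (\<lambda>t. minv (J_mat net k (X t) p)) (minv (J_mat net k A p))"
  by (rule mat_lim_minv[OF mat_lim_J[OF p]];
      rule posdef_det_nonzero[OF slot_covariance.J_posdef[OF slot[OF _ p]]], rule X A)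

lemma mat_lim_S:
  assumes p: "p \<in> Act"
  shows "mat_lim (d p) (d p) (\<lambda>t. S (X t) p) (S A p)"
  unfolding Gamma_upd_def
  by (intro mat_lim_add mat_lim_const one_carrier_mat)
    (rule mat_lim_mult[OF mat_lim_mult[OF mat_lim_mult[OF mat_lim_mult[OF mat_lim_adjoint[OF lim[OF p]]
        mat_lim_adjoint[OF mat_lim_chan[OF p p]]] mat_lim_minv_M[OF p]] mat_lim_chan[OF p p]] lim[OF p]])

lemma mat_lim_Y:
  assumes p: "p \<in> Act"
  shows "mat_lim rx (d p) (\<lambda>t. Y (X t) p) (Y A p)"
  unfolding Y_upd_def
  by (rule mat_lim_mult[OF mat_lim_mult[OF mat_lim_minv_J[OF p] mat_lim_chan[OF p p]] lim[OF p]])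

lemma mat_lim_Lambda:
  assumes p: "p \<in> Act"
  shows "mat_lim tx (d p) (\<lambda>t. Lambda_at net k (X t) p) (Lambda_at net k A p)"
  unfolding Lambda_at_def Lambda_mat_def
  by (rule mat_lim_smult[OF tendsto_const mat_lim_mult[OF mat_lim_mult[OF
        mat_lim_adjoint[OF mat_lim_chan[OF p p]] mat_lim_Y[OF p]] mat_lim_S[OF p]]])

lemma mat_lim_L:
  assumes p: "p \<in> Act"
  shows "mat_lim tx tx (\<lambda>t. L_at net k (X t) p) (L_at net k A p)"
  unfolding L_at_def L_mat_def
proof (rule mat_lim_msum)
  fix q assume "q \<in> co p"
  then have q: "q \<in> Act" by (rule co_Act)
  show "mat_lim tx tx
      (\<lambda>t. complex_of_real (\<rho> q) \<cdot>\<^sub>m L_term (X t) p q) (complex_of_real (\<rho> q) \<cdot>\<^sub>m L_term A p q)"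
    unfolding Psi_mat_def
    by (rule mat_lim_smult[OF tendsto_const mat_lim_mult[OF mat_lim_mult[OF
          mat_lim_adjoint[OF mat_lim_chan[OF q p]] mat_lim_mult[OF mat_lim_mult[OF
          mat_lim_Y[OF q] mat_lim_S[OF q]] mat_lim_adjoint[OF mat_lim_Y[OF q]]]] mat_lim_chan[OF q p]]])
qed

lemma mat_lim_Dir:
  assumes p: "p \<in> Act"
  shows "mat_lim tx (d p) (\<lambda>t. Dir (X t) p) (Dir A p)"
  unfolding Dir_def by (rule mat_lim_diff[OF mat_lim_Lambda[OF p] mat_lim_mult[OF mat_lim_L[OF p] lim[OF p]]])

end

section \<open>Norm and gradient on beamformer families\<close>

lemma fam_inner_eq: "fam_inner net k A B = (\<Sum>p\<in>Act. mip (A p) (B p))"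
  by (simp add: fam_inner_def mip_def)

lemma fam_norm_square: "(fam_norm net k A)\<^sup>2 = (\<Sum>p\<in>Act. mip (A p) (A p))"
  by (simp add: fam_norm_def fam_inner_eq sum_nonneg mip_self_nonneg)

lemma fam_norm_nonneg: "0 \<le> fam_norm net k A"
  by (simp add: fam_norm_def fam_inner_eq sum_nonneg mip_self_nonneg)

lemma mip_le_fam_norm:
  assumes "p \<in> Act"
  shows "mip (A p) (A p) \<le> (fam_norm net k A)\<^sup>2"
  unfolding fam_norm_square
  by (rule member_le_sum[OF assms _ finite_Act]) (rule mip_self_nonneg)

lemma fam_norm_limit:
  assumes X: "\<And>t. X t \<in> beam_space net k" and A: "A \<in> beam_space net k"
    and lim: "(\<lambda>t. fam_norm net k (fam_diff (X t) A)) \<longlonglongrightarrow> 0" and p: "p \<in> Act"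
  shows "mat_lim tx (d p) (\<lambda>t. X t p) (A p)"
proof (rule mat_limI[OF beam_carrier[OF A p] beam_carrier[OF X p]])
  fix i j assume ij: "i < tx" "j < d p"
  have "cmod (X t p $$ (i, j) - A p $$ (i, j)) \<le> fam_norm net k (fam_diff (X t) A)" for t
  proof (rule power2_le_imp_le[OF _ fam_norm_nonneg])
    have c: "fam_diff (X t) A p \<in> carrier_mat tx (d p)"
      unfolding fam_diff_def by (rule minus_carrier_mat[OF beam_carrier[OF A p]])
    have "X t p $$ (i, j) - A p $$ (i, j) = fam_diff (X t) A p $$ (i, j)"
      using ij beam_carrier[OF A p] by (simp add: fam_diff_def)
    also have "(cmod \<dots>)\<^sup>2 \<le> mip (fam_diff (X t) A p) (fam_diff (X t) A p)"
      by (rule cmod_le_mip) (use c ij in auto)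
    also have "\<dots> \<le> (fam_norm net k (fam_diff (X t) A))\<^sup>2" by (rule mip_le_fam_norm[OF p])
    finally show "(cmod (X t p $$ (i, j) - A p $$ (i, j)))\<^sup>2 \<le> (fam_norm net k (fam_diff (X t) A))\<^sup>2" .
  qed
  then have "(\<lambda>t. X t p $$ (i, j) - A p $$ (i, j)) \<longlonglongrightarrow> 0"
    by (intro tendsto_0_le[OF lim, of _ 1] always_eventually) (simp add: fam_norm_nonneg)
  then show "(\<lambda>t. X t p $$ (i, j)) \<longlonglongrightarrow> A p $$ (i, j)" by (rule LIM_zero_cancel)
qed

text \<open>With frozen auxiliary variables the objective is quadratic in \<open>V\<close>. At the
  centre \<open>Z\<close> its gradient is \<open>2 (Lambda + (lam - L) Z - lam Z)\<close>; there
  \<open>lam\<close> cancels and \<open>2 Dir\<close> remains, while the second-order term keeps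
  \<open>lam\<close>.\<close>

lemma f_P4_diff:
  assumes Z: "Z \<in> beam_space net k" and V: "V \<in> beam_space net k"
  shows "f_P4 net k l V (Gamma_upd net k Z) (Y_upd net k Z) Z
      - f_P4 net k l Z (Gamma_upd net k Z) (Y_upd net k Z) Z
    = (\<Sum>p\<in>Act. 2 * mip (Dir Z p) (fam_diff V Z p) - l p * mip (fam_diff V Z p) (fam_diff V Z p))"
  unfolding f_P4_def Let_def sum_subtractf[symmetric] Lambda_at_def[symmetric] L_at_def[symmetric]
proof (rule sum.cong[OF refl])
  fix p assume p: "p \<in> Act"
  define L where "L = L_at net k Z p"
  define Lam where "Lam = Lambda_at net k Z p"
  define T where "T = complex_of_real (l p) \<cdot>\<^sub>m 1\<^sub>m tx - L"
  note Vp = beam_carrier[OF V p] and Zp = beam_carrier[OF Z p]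
  have L: "L \<in> carrier_mat tx tx" using L_carrier[OF Z p] by (simp add: L_def)
  have Lam: "Lam \<in> carrier_mat tx (d p)" using Lambda_carrier[OF Z p] by (simp add: Lam_def)
  have LZ: "L * Z p \<in> carrier_mat tx (d p)" by (rule mult_carrier_mat[OF L Zp])
  have T: "T \<in> carrier_mat tx tx" unfolding T_def by (rule minus_carrier_mat[OF L])
  have cross: "Re (tr (mat_adjoint W * Lam + mat_adjoint W * T * Z p)) = mip W Lam + (l p * mip W (Z p) - mip W (L * Z p))"
    if W: "W \<in> carrier_mat tx (d p)" for W
  proof -
    have "mat_adjoint W * T * Z p = mat_adjoint W * (T * Z p)"
      by (rule mat_mult_assoc) (use W T Zp in auto)
    moreover have "mat_adjoint W * Lam \<in> carrier_mat (d p) (d p)" "mat_adjoint W * (T * Z p) \<in> carrier_mat (d p) (d p)"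
      using W Lam T Zp by (auto intro!: mult_carrier_mat[of _ "d p" tx] mult_carrier_mat[of _ tx tx])
    ultimately show ?thesis
      using mip_shift[OF L W Zp, of "l p"] by (simp add: tr_add mip_def[symmetric] T_def)
  qed
  have D: "mip (Dir Z p) (V p - Z p) = mip (V p) Lam - mip (V p) (L * Z p) - (mip (Z p) Lam - mip (Z p) (L * Z p))"
    unfolding Dir_def L_def[symmetric] Lam_def[symmetric]
    using Vp Zp Lam LZ mip_commute[OF Lam Vp] mip_commute[OF Lam Zp] mip_commute[OF LZ Vp] mip_commute[OF LZ Zp]
    by (simp add: mip_diff_left[of _ tx "d p"] mip_diff_right[of _ tx "d p"])
  have Q: "mip (V p - Z p) (V p - Z p) = mip (V p) (V p) - 2 * mip (V p) (Z p) + mip (Z p) (Z p)"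
    using Vp Zp mip_commute[OF Zp Vp] by (simp add: mip_diff_left[of _ tx "d p"] mip_diff_right[of _ tx "d p"])
  show "\<rho> p * logdet (S Z p) - \<rho> p * Re (tr (Gamma_upd net k Z p))
      - \<rho> p * noise * Re (tr (mat_adjoint (Y Z p) * Y Z p * (S Z p)))
      - l p * Re (tr (mat_adjoint (V p) * V p))
      + 2 * Re (tr (mat_adjoint (V p) * Lambda_at net k Z p
          + mat_adjoint (V p) * (complex_of_real (l p) \<cdot>\<^sub>m 1\<^sub>m tx - L_at net k Z p) * Z p))
      - Re (tr (mat_adjoint (Z p) * (complex_of_real (l p) \<cdot>\<^sub>m 1\<^sub>m tx - L_at net k Z p) * Z p))
      - (\<rho> p * logdet (S Z p) - \<rho> p * Re (tr (Gamma_upd net k Z p))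
      - \<rho> p * noise * Re (tr (mat_adjoint (Y Z p) * Y Z p * (S Z p)))
      - l p * Re (tr (mat_adjoint (Z p) * Z p))
      + 2 * Re (tr (mat_adjoint (Z p) * Lambda_at net k Z p
          + mat_adjoint (Z p) * (complex_of_real (l p) \<cdot>\<^sub>m 1\<^sub>m tx - L_at net k Z p) * Z p))
      - Re (tr (mat_adjoint (Z p) * (complex_of_real (l p) \<cdot>\<^sub>m 1\<^sub>m tx - L_at net k Z p) * Z p)))
    = 2 * mip (Dir Z p) (fam_diff V Z p) - l p * mip (fam_diff V Z p) (fam_diff V Z p)"
    unfolding L_def[symmetric] Lam_def[symmetric] T_def[symmetric] cross[OF Vp] cross[OF Zp]
      mip_def[symmetric] fam_diff_def D Q
    by (simp add: algebra_simps)
qed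

lemma f_P4_gradient:
  assumes Z: "Z \<in> beam_space net k"
  shows "has_gradient net k (\<lambda>V. f_P4 net k l V (Gamma_upd net k Z) (Y_upd net k Z) Z) Z
    (\<lambda>p. complex_of_real 2 \<cdot>\<^sub>m Dir Z p)"
  unfolding has_gradient_def
proof (intro conjI allI impI)
  show "(\<lambda>p. complex_of_real 2 \<cdot>\<^sub>m Dir Z p) \<in> beam_space net k"
    unfolding beam_space_def using Dir_carrier[OF Z] by (simp del: of_real_numeral)
  fix \<epsilon> :: real assume e: "0 < \<epsilon>"
  \<comment> \<open>\<open>K\<close> dominates the second-order coefficients. Absolute values are
    taken because \<open>l\<close> has no prescribed sign here; the added 1 makes the radius
    \<open>\<epsilon> / K\<close> meaningful when all coefficients vanish.\<close>
  define K where "K = (\<Sum>p\<in>Act. \<bar>l p\<bar>) + 1"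
  have K: "0 < K" unfolding K_def by (intro add_nonneg_pos sum_nonneg) auto
  show "\<exists>\<delta>>0. \<forall>W\<in>beam_space net k. fam_norm net k (fam_diff W Z) < \<delta> \<longrightarrow>
      \<bar>f_P4 net k l W (Gamma_upd net k Z) (Y_upd net k Z) Z
        - f_P4 net k l Z (Gamma_upd net k Z) (Y_upd net k Z) Z
        - fam_inner net k (\<lambda>p. complex_of_real 2 \<cdot>\<^sub>m Dir Z p) (fam_diff W Z)\<bar>
      \<le> \<epsilon> * fam_norm net k (fam_diff W Z)"
  proof (intro exI[of _ "\<epsilon> / K"] conjI ballI impI)
    show "0 < \<epsilon> / K" using e K by simp
    fix W assume W: "W \<in> beam_space net k" and small: "fam_norm net k (fam_diff W Z) < \<epsilon> / K"
    let ?n = "fam_norm net k (fam_diff W Z)"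
    have c: "fam_diff W Z p \<in> carrier_mat tx (d p)" if "p \<in> Act" for p
      unfolding fam_diff_def by (rule minus_carrier_mat[OF beam_carrier[OF Z that]])
    have "fam_inner net k (\<lambda>p. complex_of_real 2 \<cdot>\<^sub>m Dir Z p) (fam_diff W Z)
        = (\<Sum>p\<in>Act. 2 * mip (Dir Z p) (fam_diff W Z p))"
      unfolding fam_inner_eq by (rule sum.cong[OF refl]) (rule mip_smult_left[OF Dir_carrier[OF Z] c])
    then have "\<bar>f_P4 net k l W (Gamma_upd net k Z) (Y_upd net k Z) Z
        - f_P4 net k l Z (Gamma_upd net k Z) (Y_upd net k Z) Z
        - fam_inner net k (\<lambda>p. complex_of_real 2 \<cdot>\<^sub>m Dir Z p) (fam_diff W Z)\<bar>
        = \<bar>\<Sum>p\<in>Act. l p * mip (fam_diff W Z p) (fam_diff W Z p)\<bar>"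
      by (simp add: f_P4_diff[OF Z W] sum_subtractf)
    also have "\<dots> \<le> (\<Sum>p\<in>Act. \<bar>l p\<bar> * ?n\<^sup>2)"
      by (rule order.trans[OF sum_abs], rule sum_mono)
        (simp add: abs_mult mip_self_nonneg mult_left_mono mip_le_fam_norm)
    also have "\<dots> = (\<Sum>p\<in>Act. \<bar>l p\<bar>) * ?n\<^sup>2" by (simp add: sum_distrib_right)
    also have "\<dots> \<le> K * ?n\<^sup>2" by (rule mult_right_mono) (simp_all add: K_def)
    also have "\<dots> = (K * ?n) * ?n" by (simp add: power2_eq_square)
    also have "\<dots> \<le> \<epsilon> * ?n"
      using small K fam_norm_nonneg by (intro mult_right_mono) (simp_all add: pos_less_divide_eq mult.commute)
    finally show "\<bar>f_P4 net k l W (Gamma_upd net k Z) (Y_upd net k Z) Z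
        - f_P4 net k l Z (Gamma_upd net k Z) (Y_upd net k Z) Z
        - fam_inner net k (\<lambda>p. complex_of_real 2 \<cdot>\<^sub>m Dir Z p) (fam_diff W Z)\<bar> \<le> \<epsilon> * ?n" .
  qed
qed

text \<open>The feasible set is a product of balls and the inner product a sum over slots, so the
  slotwise inequalities add up. One gradient, twice \<open>Dir Z\<close>, serves every choice of
  \<open>lam\<close>.\<close>

lemma stationaryI:
  assumes Z: "feasible net k Z"
    and var: "\<And>p U. p \<in> Act \<Longrightarrow> U \<in> carrier_mat tx (d p) \<Longrightarrow> mip U U \<le> P \<Longrightarrow>
      mip (Dir Z p) (U - Z p) \<le> 0"
  shows "stationary net k Z"
  unfolding stationary_def Let_def
proof (intro conjI allI impI Z)
  fix l :: "slot \<Rightarrow> real"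
  have Zb: "Z \<in> beam_space net k" using Z by (simp add: feasible_iff)
  show "\<exists>G. has_gradient net k (\<lambda>V. f_P4 net k l V (Gamma_upd net k Z) (Y_upd net k Z) Z) Z G \<and>
      (\<forall>V. feasible net k V \<longrightarrow> fam_inner net k G (fam_diff V Z) \<le> 0)"
  proof (intro exI conjI allI impI)
    show "has_gradient net k (\<lambda>V. f_P4 net k l V (Gamma_upd net k Z) (Y_upd net k Z) Z) Z
        (\<lambda>p. complex_of_real 2 \<cdot>\<^sub>m Dir Z p)"
      by (rule f_P4_gradient[OF Zb])
    fix V assume V: "feasible net k V"
    have "mip (complex_of_real 2 \<cdot>\<^sub>m Dir Z p) (fam_diff V Z p) \<le> 0" if p: "p \<in> Act" for p
    proof -
      have Vp: "V p \<in> carrier_mat tx (d p)" "mip (V p) (V p) \<le> P"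
        using V p by (auto simp: feasible_iff intro: beam_carrier)
      have c: "V p - Z p \<in> carrier_mat tx (d p)" by (rule minus_carrier_mat[OF beam_carrier[OF Zb p]])
      show ?thesis
        unfolding fam_diff_def mip_smult_left[OF Dir_carrier[OF Zb p] c] using var[OF p Vp] by simp
    qed
    then show "fam_inner net k (\<lambda>p. complex_of_real 2 \<cdot>\<^sub>m Dir Z p) (fam_diff V Z) \<le> 0"
      unfolding fam_inner_eq by (rule sum_nonpos)
  qed
qed

end

context relaxed_iteration
begin

text \<open>The asymptotic inequality is stated at \<open>V n\<close> alone, so continuity of
  \<open>Dir\<close> carries it to the limit along the subsequence, whatever the successors
  \<open>V (Suc (r n))\<close> do.\<close>

lemma accumulation_point_stationary:
  assumes B: "\<And>n p. p \<in> Act \<Longrightarrow> l n p \<le> B" and acc: "accumulation_point net k V Z"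
  shows "stationary net k Z"
proof -
  obtain r where r: "strict_mono r" "(\<lambda>n. fam_norm net k (fam_diff (V (r n)) Z)) \<longlonglongrightarrow> 0"
    and Z: "Z \<in> beam_space net k"
    using acc by (auto simp: accumulation_point_def)
  have lim: "mat_lim tx (d p) (\<lambda>n. V (r n) p) (Z p)" if "p \<in> Act" for p
    by (rule fam_norm_limit[OF V_beam Z r(2) that])
  show ?thesis
  proof (rule stationaryI)
    show "feasible net k Z"
      unfolding feasible_iff
    proof (intro conjI ballI Z)
      fix p assume p: "p \<in> Act"
      show "mip (Z p) (Z p) \<le> P"
        by (rule LIMSEQ_le_const2[OF tendsto_mip[OF lim[OF p] lim[OF p]]]) (use V_power[OF p] in auto)
    qed
    fix p U assume p: "p \<in> Act" and U: "U \<in> carrier_mat tx (d p)" "mip U U \<le> P"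
    obtain e where e: "e \<longlonglongrightarrow> 0" "\<And>n. mip (Dir (V n) p) (U - V n p) \<le> e n"
      using asymptotic_variational[OF p B[OF p] U] by blast
    have "(\<lambda>n. mip (Dir (V (r n)) p) (U - V (r n) p)) \<longlonglongrightarrow> mip (Dir Z p) (U - Z p)"
      by (rule tendsto_mip[OF mat_lim_Dir[OF V_beam Z lim p] mat_lim_diff[OF mat_lim_const[OF U(1)] lim[OF p]]])
    moreover have "(\<lambda>n. e (r n)) \<longlonglongrightarrow> 0"
      using LIMSEQ_subseq_LIMSEQ[OF e(1) r(1)] by (simp add: comp_def)
    ultimately show "mip (Dir Z p) (U - Z p) \<le> 0"
      by (rule LIMSEQ_le) (use e(2) in auto)
  qed
qed

end

text \<open>The upper bound on \<open>lam\<close> guards the first claim. If the reciprocals of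
  \<open>lam\<close> have a small enough sum, the total movement is small, and iterates started at a
  non-stationary point converge to a non-stationary point; the lower bound by
  \<open>lambda_max\<close> does not exclude this. The second claim rests on ascent and boundedness
  of the rate.\<close>

theorem theorem1:
  fixes net :: network
    and k :: allocation
    and V :: "nat \<Rightarrow> mat_family"
    and lam alpha :: "nat \<Rightarrow> slot \<Rightarrow> real"
    and C :: "real set"
  assumes net: "valid_network net"
    and alloc: "rbg_allocation net k"
    and init: "feasible net k (V 0)"
    and iter: "\<And>\<tau> p. 1 \<le> \<tau> \<Longrightarrow> p \<in> active net k \<Longrightarrow>
                 V \<tau> p = relaxed_step net k (lam \<tau> p) (alpha \<tau> p) (V (\<tau> - 1)) p"
    and lam_pos: "\<And>\<tau> p. 1 \<le> \<tau> \<Longrightarrow> p \<in> active net k \<Longrightarrow> 0 < lam \<tau> p"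
    and lam_ge: "\<And>\<tau> p. 1 \<le> \<tau> \<Longrightarrow> p \<in> active net k \<Longrightarrow>
                   lambda_max (L_at net k (V (\<tau> - 1)) p) \<le> lam \<tau> p"
    and alpha_compact: "compact C" "C \<subseteq> {0<..<2}"
    and alpha_in: "\<And>\<tau> p. 1 \<le> \<tau> \<Longrightarrow> p \<in> active net k \<Longrightarrow> alpha \<tau> p \<in> C"
  shows "((\<exists>B. \<forall>\<tau>\<ge>1. \<forall>p\<in>active net k. lam \<tau> p \<le> B) \<longrightarrow>
            (\<forall>Vs. accumulation_point net k V Vs \<longrightarrow> stationary net k Vs))
         \<and> convergent (\<lambda>\<tau>. wsr net k (V \<tau>))"
proof -
  interpret relaxed_iteration net k V lam alpha C
    by unfold_locales (fact assms)+
  show ?thesis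
  proof (intro conjI impI allI wsr_convergent)
    fix Vs assume "\<exists>B. \<forall>\<tau>\<ge>1. \<forall>p\<in>active net k. lam \<tau> p \<le> B" and acc: "accumulation_point net k V Vs"
    then obtain B where B: "\<forall>\<tau>\<ge>1. \<forall>p\<in>active net k. lam \<tau> p \<le> B" by blast
    show "stationary net k Vs"
      by (rule accumulation_point_stationary[OF _ acc, of B]) (use B in simp)
  qed
qed

end
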